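(* Let $\varphi$ be a formula of the relevance language $\mathcal{L}_R$ on which the procedure PEARL succeeds. Then for every relevant algebra $\mathbb{A}$: if $\varphi$ is valid on $\mathbb{A}$, then $\varphi$ is valid on the canonical extension $\mathbb{A}^{\delta}$ of $\mathbb{A}$.
   Context: $\mathcal{L}_R$-formulas: $A::=p\mid\bot\mid\top\mid\mathbf{t}\mid\mathord{\sim}A\mid A\wedge A\mid A\vee A\mid A\circ A\mid A\to A$. A relevant algebra is $\mathbb{A}=\langle A,\wedge,\vee,\circ,\to,\mathord{\sim},\mathbf{t},\top,\bot\rangle$ with: a bounded distributive lattice reduct; $\circ$ distributing over binary $\vee$ in each coordinate; $\mathord{\sim}(a\vee b)=\mathord{\sim}a\wedge\mathord{\sim}b$, $\mathord{\sim}(a\wedge b)=\mathord{\sim}a\vee\mathord{\sim}b$, $\mathord{\sim}\top=\bot$, $\mathord{\sim}\bot=\top$; $a\circ\bot=\bot\circ a=\bot$; $\mathbf{t}\circ a=a$; $a\circ b\le c$ iff $a\le b\to c$. A formula $\varphi$ is valid on $\mathbb{A}$ if $\mathbf{t}\le\varphi$ holds under every assignment of the variables in $A$. A relevant algebra is perfect if its lattice is complete, completely distributive, join-generated by its completely join-irreducibles $J^\infty$ and meet-generated by its completely meet-irreducibles $M^\infty$, $\circ$ preserves arbitrary joins in each coordinate, $\to$ turns arbitrary joins in the first coordinate into meets and preserves arbitrary meets in the second, and $\mathord{\sim}$ turns arbitrary joins into meets and meets into joins. Every relevant algebra $\mathbb{A}$ embeds densely and compactly into a unique perfect relevant algebra,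 its canonical extension $\mathbb{A}^{\delta}$. A perfect relevant algebra also interprets the extended language $\mathcal{L}^+_R$, which adds nominals $\mathbf{i},\mathbf{j},\ldots$ (ranging over $J^\infty$), co-nominals $\mathbf{m},\mathbf{n},\ldots$ (ranging over $M^\infty$), and connectives $\mathord{\sim}^\flat,\mathord{\sim}^\sharp,\Rightarrow,-\!\!<,\,\triangleright$ defined by: $\mathord{\sim}a\le b$ iff $\mathord{\sim}^\flat b\le a$; $a\le\mathord{\sim}b$ iff $b\le\mathord{\sim}^\sharp a$; $a\le b\vee c$ iff $a-\!\!<b\le c$; $a\wedge b\le c$ iff $a\le b\Rightarrow c$; $a\circ b\le c$ iff $b\le a\triangleright c$. Polarities: $\mathord{\sim},\mathord{\sim}^\flat,\mathord{\sim}^\sharp$ are antitone; $\wedge,\vee,\circ$ monotone in both arguments; $\to,\Rightarrow,\triangleright$ antitone in the first and monotone in the second; $-\!\!<$ monotone in the first, antitone in the second. An occurrence of an atom is positive/negative according to the parity of antitone positions above it; a formula is positive (negative) in $p$ if all occurrences of $p$ are positive (negative); an inequality $\alpha\le\beta$ is positive (negative) in $p$ if $\alpha$ is negative (positive) and $\beta$ positive (negative) in $p$. A quasi-inequality is $\Gamma\Rightarrow\alpha\le\beta$ with $\Gamma$ a finite set of $\mathcal{L}^+_R$-inequalities; it is pure if it contains no propositional variables. PEARL succeeds on $\varphi$ if, starting from the inequality $\psi\le\theta$ when $\varphi=\psi\to\theta$ and from $\mathbf{t}\le\varphi$ otherwise, some finite sequence of applications of the following rules (read top-to-bottom; $\Gamma$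 denotes untouched context) yields a pure quasi-inequality (when several are produced by splitting, all of them pure). Monotone elimination: from $\Gamma(p)\Rightarrow\gamma(p)\le\beta(p)$ with $\beta,\Gamma$ positive and $\gamma$ negative in $p$, infer $\Gamma(\top/p)\Rightarrow\gamma(\bot/p)\le\beta(\bot/p)$; dually, from $\Delta(p)\Rightarrow\beta(p)\le\gamma(p)$ with $\beta$ positive, $\gamma,\Delta$ negative in $p$, infer $\Delta(\bot/p)\Rightarrow\beta(\top/p)\le\gamma(\top/p)$. First approximation: from $\Gamma\Rightarrow\varphi\le\psi$ infer $\mathbf{j}\le\varphi,\psi\le\mathbf{m},\Gamma\Rightarrow\mathbf{j}\le\mathbf{m}$ (fresh $\mathbf{j},\mathbf{m}$). Approximation (fresh $\mathbf{j},\mathbf{n}$): premise $\chi\to\varphi\le\mathbf{m}$ may be replaced by $\mathbf{j}\le\chi,\ \mathbf{j}\to\varphi\le\mathbf{m}$ or by $\varphi\le\mathbf{n},\ \chi\to\mathbf{n}\le\mathbf{m}$; premise $\mathbf{i}\le\chi\circ\varphi$ by $\mathbf{j}\le\chi,\ \mathbf{i}\le\mathbf{j}\circ\varphi$ or by $\mathbf{j}\le\varphi,\ \mathbf{i}\le\chi\circ\mathbf{j}$; premise $\mathord{\sim}\varphi\le\mathbf{m}$ by $\varphi\le\mathbf{n},\ \mathord{\sim}\mathbf{n}\le\mathbf{m}$; premise $\mathbf{i}\le\mathord{\sim}\varphi$ by $\mathbf{j}\le\varphi,\ \mathbf{i}\le\mathord{\sim}\mathbf{j}$. Residuation/adjunction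 (premises, both directions): $\varphi\le\chi\vee\psi$ $\leftrightarrow$ $\varphi-\!\!<\chi\le\psi$; $\varphi\wedge\chi\le\psi$ $\leftrightarrow$ $\varphi\le\chi\Rightarrow\psi$; $\varphi\le\chi\to\psi$ $\leftrightarrow$ $\varphi\circ\chi\le\psi$; $\psi\le\varphi\triangleright\chi$ $\leftrightarrow$ $\varphi\circ\psi\le\chi$; $\varphi\vee\chi\le\psi$ $\leftrightarrow$ $\varphi\le\psi,\chi\le\psi$; $\psi\le\varphi\wedge\chi$ $\leftrightarrow$ $\psi\le\varphi,\psi\le\chi$; $\mathord{\sim}\varphi\le\psi$ $\leftrightarrow$ $\mathord{\sim}^\flat\psi\le\varphi$; $\varphi\le\mathord{\sim}\psi$ $\leftrightarrow$ $\psi\le\mathord{\sim}^\sharp\varphi$ (commuting arguments of $\wedge,\vee$ allowed). Ackermann: if $p$ does not occur in $\alpha$, from $\alpha\le p,\Delta(p)\Rightarrow\gamma(p)\le\beta(p)$ with $\beta,\Delta$ positive and $\gamma$ negative in $p$ infer $\Delta(\alpha/p)\Rightarrow\gamma(\alpha/p)\le\beta(\alpha/p)$; from $p\le\alpha,\Gamma(p)\Rightarrow\beta(p)\le\gamma(p)$ with $\beta$ positive and $\gamma,\Gamma$ negative in $p$ infer $\Gamma(\alpha/p)\Rightarrow\beta(\alpha/p)\le\gamma(\alpha/p)$. Simplification: $\Gamma,\mathbf{i}\le\varphi\Rightarrow\mathbf{i}\le\psi$ becomes $\Gamma\Rightarrow\varphi\le\psi$ when $\mathbf{i}$ occurs nowhere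 else; $\Gamma,\psi\le\mathbf{m}\Rightarrow\varphi\le\mathbf{m}$ becomes $\Gamma\Rightarrow\varphi\le\psi$ when $\mathbf{m}$ occurs nowhere else. Splitting: an inequality with a top-level (or distributable) positive $\vee$ / negative $\wedge$ on the left or positive $\wedge$ / negative $\vee$ on the right may be split into two inequalities.
   Formalization: Three PEARL rules, unsound as stated, are corrected: monotone elimination and Ackermann need context premises of sign opposite to the conclusion (elimination uses one constant throughout); approximation of ∼φ≤m uses j≤φ, ∼j≤m, and of i≤∼φ uses φ≤n, i≤∼n. *)

theory Defs
  imports Main "HOL-Library.FSet"
begin

section \<open>Relevant algebras and their canonical extensions\<close>

class relevant_algebra = distrib_lattice + bounded_lattice +
  fixes fusion :: "'a \<Rightarrow> 'a \<Rightarrow> 'a"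
    and rimp :: "'a \<Rightarrow> 'a \<Rightarrow> 'a"
    and rneg :: "'a \<Rightarrow> 'a"
    and runit :: "'a"
  assumes fusion_sup_left: "fusion (sup a b) c = sup (fusion a c) (fusion b c)"
    and fusion_sup_right: "fusion a (sup b c) = sup (fusion a b) (fusion a c)"
    and rneg_sup: "rneg (sup a b) = inf (rneg a) (rneg b)"
    and rneg_inf: "rneg (inf a b) = sup (rneg a) (rneg b)"
    and rneg_top: "rneg top = bot"
    and rneg_bot: "rneg bot = top"
    and fusion_bot_right: "fusion a bot = bot"
    and fusion_bot_left: "fusion bot a = bot"
    and fusion_runit: "fusion runit a = a"
    and fusion_residual: "fusion a b \<le> c \<longleftrightarrow> a \<le> rimp b c"

(* The case S = {} excludes bot, respectively top. *)
definition (in complete_lattice) completely_join_irreducible :: "'a \<Rightarrow> bool"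
  where "completely_join_irreducible x \<longleftrightarrow> (\<forall>S. x = Sup S \<longrightarrow> x \<in> S)"

definition (in complete_lattice) completely_meet_irreducible :: "'a \<Rightarrow> bool"
  where "completely_meet_irreducible x \<longleftrightarrow> (\<forall>S. x = Inf S \<longrightarrow> x \<in> S)"

(* complete_distrib_lattice is full complete distributivity (with choice
   functions), not just the frame and coframe laws. *)
class perfect_relevant_algebra = relevant_algebra + complete_distrib_lattice +
  assumes join_generated: "x = Sup {j. completely_join_irreducible j \<and> j \<le> x}"
    and meet_generated: "x = Inf {m. completely_meet_irreducible m \<and> x \<le> m}"
    and fusion_Sup_left: "fusion (Sup S) a = (SUP s\<in>S. fusion s a)"
    and fusion_Sup_right: "fusion a (Sup S) = (SUP s\<in>S. fusion a s)"
    and rimp_Sup: "rimp (Sup S) a = (INF s\<in>S. rimp s a)"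
    and rimp_Inf: "rimp a (Inf S) = (INF s\<in>S. rimp a s)"
    and rneg_Sup: "rneg (Sup S) = (INF s\<in>S. rneg s)"
    and rneg_Inf: "rneg (Inf S) = (SUP s\<in>S. rneg s)"

definition relevant_embedding :: "('a::relevant_algebra \<Rightarrow> 'b::relevant_algebra) \<Rightarrow> bool"
  where "relevant_embedding e \<longleftrightarrow> inj e \<and>
    (\<forall>a b. e (inf a b) = inf (e a) (e b)) \<and>
    (\<forall>a b. e (sup a b) = sup (e a) (e b)) \<and>
    (\<forall>a b. e (fusion a b) = fusion (e a) (e b)) \<and>
    (\<forall>a b. e (rimp a b) = rimp (e a) (e b)) \<and>
    (\<forall>a. e (rneg a) = rneg (e a)) \<and>
    e runit = runit \<and> e top = top \<and> e bot = bot"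

definition closed_element :: "('a \<Rightarrow> 'b::complete_lattice) \<Rightarrow> 'b \<Rightarrow> bool"
  where "closed_element e x \<longleftrightarrow> (\<exists>S. x = Inf (e ` S))"

definition open_element :: "('a \<Rightarrow> 'b::complete_lattice) \<Rightarrow> 'b \<Rightarrow> bool"
  where "open_element e x \<longleftrightarrow> (\<exists>S. x = Sup (e ` S))"

definition dense_map :: "('a \<Rightarrow> 'b::complete_lattice) \<Rightarrow> bool"
  where "dense_map e \<longleftrightarrow>
    (\<forall>x. \<exists>K. (\<forall>k\<in>K. closed_element e k) \<and> x = Sup K) \<and>
    (\<forall>x. \<exists>U. (\<forall>u\<in>U. open_element e u) \<and> x = Inf U)"

definition compact_map :: "('a \<Rightarrow> 'b::complete_lattice) \<Rightarrow> bool"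
  where "compact_map e \<longleftrightarrow>
    (\<forall>S T. Inf (e ` S) \<le> Sup (e ` T) \<longrightarrow>
      (\<exists>S' T'. finite S' \<and> S' \<subseteq> S \<and> finite T' \<and> T' \<subseteq> T \<and> Inf (e ` S') \<le> Sup (e ` T')))"

definition fusion_sigma ::
    "('a::relevant_algebra \<Rightarrow> 'b::complete_lattice) \<Rightarrow> 'b \<Rightarrow> 'b \<Rightarrow> 'b"
  where "fusion_sigma e x y =
    Sup {Inf {e (fusion a b) | a b. k \<le> e a \<and> l \<le> e b} | k l.
          closed_element e k \<and> closed_element e l \<and> k \<le> x \<and> l \<le> y}"

definition rimp_pi ::
    "('a::relevant_algebra \<Rightarrow> 'b::complete_lattice) \<Rightarrow> 'b \<Rightarrow> 'b \<Rightarrow> 'b"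
  where "rimp_pi e x y =
    Inf {Sup {e (rimp a b) | a b. k \<le> e a \<and> e b \<le> u} | k u.
          closed_element e k \<and> open_element e u \<and> k \<le> x \<and> y \<le> u}"

(* Density and compactness determine the lattice up to isomorphism, but several
   complete operators on it may extend fusion, so the operations have to be fixed
   as the sigma-extension of fusion and the pi-extension of implication.  There is
   no clause for negation: being completely join- and meet-reversing, it is
   determined by its values on the image of e. *)
definition canonical_extension ::
    "('a::relevant_algebra \<Rightarrow> 'b::perfect_relevant_algebra) \<Rightarrow> bool"
  where "canonical_extension e \<longleftrightarrow>
    relevant_embedding e \<and> dense_map e \<and> compact_map e \<and>
    (\<forall>x y. fusion x y = fusion_sigma e x y) \<and>
    (\<forall>x y. rimp x y = rimp_pi e x y)"


section \<open>Formulas of the relevance language\<close>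

datatype rfm =
    RVar nat | RBot | RTop | RUnit
  | RNeg rfm | RAnd rfm rfm | ROr rfm rfm | RFus rfm rfm | RImp rfm rfm

primrec eval :: "(nat \<Rightarrow> 'a::relevant_algebra) \<Rightarrow> rfm \<Rightarrow> 'a" where
  "eval v (RVar p) = v p"
| "eval v RBot = bot"
| "eval v RTop = top"
| "eval v RUnit = runit"
| "eval v (RNeg A) = rneg (eval v A)"
| "eval v (RAnd A B) = inf (eval v A) (eval v B)"
| "eval v (ROr A B) = sup (eval v A) (eval v B)"
| "eval v (RFus A B) = fusion (eval v A) (eval v B)"
| "eval v (RImp A B) = rimp (eval v A) (eval v B)"

definition valid_on :: "'a::relevant_algebra itself \<Rightarrow> rfm \<Rightarrow> bool"
  where "valid_on (_ :: 'a itself) \<phi> \<longleftrightarrow> (\<forall>v :: nat \<Rightarrow> 'a. runit \<le> eval v \<phi>)"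


section \<open>The extended language\<close>

datatype atom = PVar nat | Nom nat | CoNom nat

(* With all connectives read in a perfect algebra:
     Neg a \<le> b    iff  NegFlat b \<le> a,     a \<le> Neg b     iff  b \<le> NegSharp a,
     a \<le> Or b c   iff  CoImp a b \<le> c,     And a b \<le> c   iff  a \<le> HImp b c,
     Fus a b \<le> c  iff  a \<le> Imp b c,       Fus a b \<le> c   iff  b \<le> Tri a c. *)
datatype fm =
    At atom | Bot | Top | Unit
  | Neg fm | And fm fm | Or fm fm | Fus fm fm | Imp fm fm
  | NegFlat fm | NegSharp fm | HImp fm fm | CoImp fm fm | Tri fm fm

abbreviation "Var p \<equiv> At (PVar p)"
abbreviation "Nm j \<equiv> At (Nom j)"
abbreviation "Cn m \<equiv> At (CoNom m)"

primrec embed :: "rfm \<Rightarrow> fm" where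
  "embed (RVar p) = Var p"
| "embed RBot = Bot"
| "embed RTop = Top"
| "embed RUnit = Unit"
| "embed (RNeg A) = Neg (embed A)"
| "embed (RAnd A B) = And (embed A) (embed B)"
| "embed (ROr A B) = Or (embed A) (embed B)"
| "embed (RFus A B) = Fus (embed A) (embed B)"
| "embed (RImp A B) = Imp (embed A) (embed B)"

primrec atoms :: "fm \<Rightarrow> atom set" where
  "atoms (At x) = {x}"
| "atoms Bot = {}"
| "atoms Top = {}"
| "atoms Unit = {}"
| "atoms (Neg A) = atoms A"
| "atoms (And A B) = atoms A \<union> atoms B"
| "atoms (Or A B) = atoms A \<union> atoms B"
| "atoms (Fus A B) = atoms A \<union> atoms B"
| "atoms (Imp A B) = atoms A \<union> atoms B"
| "atoms (NegFlat A) = atoms A"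
| "atoms (NegSharp A) = atoms A"
| "atoms (HImp A B) = atoms A \<union> atoms B"
| "atoms (CoImp A B) = atoms A \<union> atoms B"
| "atoms (Tri A B) = atoms A \<union> atoms B"

(* All occurrences of p in the formula are positive (s = True) or negative (s = False). *)
primrec signed :: "bool \<Rightarrow> nat \<Rightarrow> fm \<Rightarrow> bool" where
  "signed s p (At x) \<longleftrightarrow> (x = PVar p \<longrightarrow> s)"
| "signed s p Bot \<longleftrightarrow> True"
| "signed s p Top \<longleftrightarrow> True"
| "signed s p Unit \<longleftrightarrow> True"
| "signed s p (Neg A) \<longleftrightarrow> signed (\<not> s) p A"
| "signed s p (And A B) \<longleftrightarrow> signed s p A \<and> signed s p B"
| "signed s p (Or A B) \<longleftrightarrow> signed s p A \<and> signed s p B"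
| "signed s p (Fus A B) \<longleftrightarrow> signed s p A \<and> signed s p B"
| "signed s p (Imp A B) \<longleftrightarrow> signed (\<not> s) p A \<and> signed s p B"
| "signed s p (NegFlat A) \<longleftrightarrow> signed (\<not> s) p A"
| "signed s p (NegSharp A) \<longleftrightarrow> signed (\<not> s) p A"
| "signed s p (HImp A B) \<longleftrightarrow> signed (\<not> s) p A \<and> signed s p B"
| "signed s p (CoImp A B) \<longleftrightarrow> signed s p A \<and> signed (\<not> s) p B"
| "signed s p (Tri A B) \<longleftrightarrow> signed (\<not> s) p A \<and> signed s p B"

primrec subst :: "nat \<Rightarrow> fm \<Rightarrow> fm \<Rightarrow> fm" where
  "subst p C (At x) = (if x = PVar p then C else At x)"
| "subst p C Bot = Bot"
| "subst p C Top = Top"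
| "subst p C Unit = Unit"
| "subst p C (Neg A) = Neg (subst p C A)"
| "subst p C (And A B) = And (subst p C A) (subst p C B)"
| "subst p C (Or A B) = Or (subst p C A) (subst p C B)"
| "subst p C (Fus A B) = Fus (subst p C A) (subst p C B)"
| "subst p C (Imp A B) = Imp (subst p C A) (subst p C B)"
| "subst p C (NegFlat A) = NegFlat (subst p C A)"
| "subst p C (NegSharp A) = NegSharp (subst p C A)"
| "subst p C (HImp A B) = HImp (subst p C A) (subst p C B)"
| "subst p C (CoImp A B) = CoImp (subst p C A) (subst p C B)"
| "subst p C (Tri A B) = Tri (subst p C A) (subst p C B)"


section \<open>Inequalities and quasi-inequalities\<close>

datatype ineq = Leq fm fm (infix \<open>\<preceq>\<close> 50)

primrec ineq_atoms :: "ineq \<Rightarrow> atom set" where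
  "ineq_atoms (A \<preceq> B) = atoms A \<union> atoms B"

primrec ineq_signed :: "bool \<Rightarrow> nat \<Rightarrow> ineq \<Rightarrow> bool" where
  "ineq_signed s p (A \<preceq> B) \<longleftrightarrow> signed (\<not> s) p A \<and> signed s p B"

abbreviation "ineq_positive \<equiv> ineq_signed True"
abbreviation "ineq_negative \<equiv> ineq_signed False"

primrec ineq_subst :: "nat \<Rightarrow> fm \<Rightarrow> ineq \<Rightarrow> ineq" where
  "ineq_subst p C (A \<preceq> B) = (subst p C A \<preceq> subst p C B)"

datatype quasi = Quasi "ineq fset" ineq (infix \<open>\<tturnstile>\<close> 45)

primrec quasi_atoms :: "quasi \<Rightarrow> atom set" where
  "quasi_atoms (\<Gamma> \<tturnstile> c) = (\<Union>i\<in>fset \<Gamma>. ineq_atoms i) \<union> ineq_atoms c"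

primrec quasi_subst :: "nat \<Rightarrow> fm \<Rightarrow> quasi \<Rightarrow> quasi" where
  "quasi_subst p C (\<Gamma> \<tturnstile> c) = (fimage (ineq_subst p C) \<Gamma> \<tturnstile> ineq_subst p C c)"

definition pure_quasi :: "quasi \<Rightarrow> bool"
  where "pure_quasi q \<longleftrightarrow> (\<forall>p. PVar p \<notin> quasi_atoms q)"


section \<open>The rules of PEARL\<close>

(* approx x i k l: the premise i may be replaced by k and l, where x is the fresh atom.
   In every case x is introduced in an argument of the main connective in which that
   connective turns the joins of nominals, respectively the meets of co-nominals, into
   meets on the left of an inequality and into joins on the right. *)
inductive approx :: "atom \<Rightarrow> ineq \<Rightarrow> ineq \<Rightarrow> ineq \<Rightarrow> bool" where
  imp_fst: "approx (Nom j) (Imp X A \<preceq> Cn m) (Nm j \<preceq> X) (Imp (Nm j) A \<preceq> Cn m)"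
| imp_snd: "approx (CoNom n) (Imp X A \<preceq> Cn m) (A \<preceq> Cn n) (Imp X (Cn n) \<preceq> Cn m)"
| fus_fst: "approx (Nom j) (Nm i \<preceq> Fus X A) (Nm j \<preceq> X) (Nm i \<preceq> Fus (Nm j) A)"
| fus_snd: "approx (Nom j) (Nm i \<preceq> Fus X A) (Nm j \<preceq> A) (Nm i \<preceq> Fus X (Nm j))"
| neg_left: "approx (Nom j) (Neg A \<preceq> Cn m) (Nm j \<preceq> A) (Neg (Nm j) \<preceq> Cn m)"
| neg_right: "approx (CoNom n) (Nm i \<preceq> Neg A) (A \<preceq> Cn n) (Nm i \<preceq> Neg (Cn n))"

inductive residual :: "ineq \<Rightarrow> ineq \<Rightarrow> bool" where
  coimp: "residual (A \<preceq> Or B C) (CoImp A B \<preceq> C)"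
| coimp_comm: "residual (A \<preceq> Or B C) (CoImp A C \<preceq> B)"
| himp: "residual (And A B \<preceq> C) (A \<preceq> HImp B C)"
| himp_comm: "residual (And A B \<preceq> C) (B \<preceq> HImp A C)"
| imp: "residual (A \<preceq> Imp B C) (Fus A B \<preceq> C)"
| tri: "residual (B \<preceq> Tri A C) (Fus A B \<preceq> C)"
| neg_flat: "residual (Neg A \<preceq> B) (NegFlat B \<preceq> A)"
| neg_sharp: "residual (A \<preceq> Neg B) (B \<preceq> NegSharp A)"

inductive adjunction :: "ineq \<Rightarrow> ineq \<Rightarrow> ineq \<Rightarrow> bool" where
  "adjunction (Or A B \<preceq> C) (A \<preceq> C) (B \<preceq> C)"
| "adjunction (C \<preceq> And A B) (C \<preceq> A) (C \<preceq> B)"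

(* split_join A A1 A2: distributing one positive Or or negative And outwards turns A
   into the join of A1 and A2; split_meet is dual. *)
inductive split_join :: "fm \<Rightarrow> fm \<Rightarrow> fm \<Rightarrow> bool"
  and split_meet :: "fm \<Rightarrow> fm \<Rightarrow> fm \<Rightarrow> bool" where
  "split_join (Or A B) A B"
| "split_join A A1 A2 \<Longrightarrow> split_join (And A B) (And A1 B) (And A2 B)"
| "split_join B B1 B2 \<Longrightarrow> split_join (And A B) (And A B1) (And A B2)"
| "split_join A A1 A2 \<Longrightarrow> split_join (Fus A B) (Fus A1 B) (Fus A2 B)"
| "split_join B B1 B2 \<Longrightarrow> split_join (Fus A B) (Fus A B1) (Fus A B2)"
| "split_meet A A1 A2 \<Longrightarrow> split_join (Neg A) (Neg A1) (Neg A2)"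
| "split_meet A A1 A2 \<Longrightarrow> split_join (NegFlat A) (NegFlat A1) (NegFlat A2)"
| "split_join A A1 A2 \<Longrightarrow> split_join (CoImp A B) (CoImp A1 B) (CoImp A2 B)"
| "split_meet B B1 B2 \<Longrightarrow> split_join (CoImp A B) (CoImp A B1) (CoImp A B2)"
| "split_meet (And A B) A B"
| "split_meet A A1 A2 \<Longrightarrow> split_meet (Or A B) (Or A1 B) (Or A2 B)"
| "split_meet B B1 B2 \<Longrightarrow> split_meet (Or A B) (Or A B1) (Or A B2)"
| "split_join A A1 A2 \<Longrightarrow> split_meet (Imp A B) (Imp A1 B) (Imp A2 B)"
| "split_meet B B1 B2 \<Longrightarrow> split_meet (Imp A B) (Imp A B1) (Imp A B2)"
| "split_join A A1 A2 \<Longrightarrow> split_meet (Neg A) (Neg A1) (Neg A2)"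
| "split_join A A1 A2 \<Longrightarrow> split_meet (NegSharp A) (NegSharp A1) (NegSharp A2)"
| "split_join A A1 A2 \<Longrightarrow> split_meet (HImp A B) (HImp A1 B) (HImp A2 B)"
| "split_meet B B1 B2 \<Longrightarrow> split_meet (HImp A B) (HImp A B1) (HImp A B2)"
| "split_join A A1 A2 \<Longrightarrow> split_meet (Tri A B) (Tri A1 B) (Tri A2 B)"
| "split_meet B B1 B2 \<Longrightarrow> split_meet (Tri A B) (Tri A B1) (Tri A B2)"

inductive split_ineq :: "ineq \<Rightarrow> ineq \<Rightarrow> ineq \<Rightarrow> bool" where
  "split_join A A1 A2 \<Longrightarrow> split_ineq (A \<preceq> B) (A1 \<preceq> B) (A2 \<preceq> B)"
| "split_meet B B1 B2 \<Longrightarrow> split_ineq (A \<preceq> B) (A \<preceq> B1) (A \<preceq> B2)"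

(* pearl_rule q qs: q may be replaced by the quasi-inequalities in qs, of which there
   are two only when the consequent is split.

   Pitfall: for a premise, being negative in p makes it easier to satisfy as p
   decreases.  So in mono_bot and ackermann_right, where the consequent is positive in
   p and hence hardest to satisfy for the least p, the premises have to be negative in
   p, and mono_bot substitutes the same constant in premises and consequent; dually
   for the other two.  With the opposite sign for the premises the rules are unsound. *)
inductive pearl_rule :: "quasi \<Rightarrow> quasi list \<Rightarrow> bool" where
  mono_bot:
    "\<lbrakk>ineq_positive p c; \<forall>i\<in>fset \<Gamma>. ineq_negative p i\<rbrakk>
      \<Longrightarrow> pearl_rule (\<Gamma> \<tturnstile> c) [quasi_subst p Bot (\<Gamma> \<tturnstile> c)]"
| mono_top:
    "\<lbrakk>ineq_negative p c; \<forall>i\<in>fset \<Gamma>. ineq_positive p i\<rbrakk>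
      \<Longrightarrow> pearl_rule (\<Gamma> \<tturnstile> c) [quasi_subst p Top (\<Gamma> \<tturnstile> c)]"
| first_approximation:
    "\<lbrakk>Nom j \<notin> quasi_atoms (\<Gamma> \<tturnstile> A \<preceq> B); CoNom m \<notin> quasi_atoms (\<Gamma> \<tturnstile> A \<preceq> B)\<rbrakk>
      \<Longrightarrow> pearl_rule (\<Gamma> \<tturnstile> A \<preceq> B)
            [finsert (Nm j \<preceq> A) (finsert (B \<preceq> Cn m) \<Gamma>) \<tturnstile> Nm j \<preceq> Cn m]"
| approximation:
    "\<lbrakk>approx x i k l; x \<notin> quasi_atoms (finsert i \<Gamma> \<tturnstile> c)\<rbrakk>
      \<Longrightarrow> pearl_rule (finsert i \<Gamma> \<tturnstile> c) [finsert k (finsert l \<Gamma>) \<tturnstile> c]"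
| residuation:
    "residual i k \<Longrightarrow> pearl_rule (finsert i \<Gamma> \<tturnstile> c) [finsert k \<Gamma> \<tturnstile> c]"
| residuation_inv:
    "residual i k \<Longrightarrow> pearl_rule (finsert k \<Gamma> \<tturnstile> c) [finsert i \<Gamma> \<tturnstile> c]"
| adjunction:
    "adjunction i k l
      \<Longrightarrow> pearl_rule (finsert i \<Gamma> \<tturnstile> c) [finsert k (finsert l \<Gamma>) \<tturnstile> c]"
| adjunction_inv:
    "adjunction i k l
      \<Longrightarrow> pearl_rule (finsert k (finsert l \<Gamma>) \<tturnstile> c) [finsert i \<Gamma> \<tturnstile> c]"
| ackermann_right:
    "\<lbrakk>PVar p \<notin> atoms A; ineq_positive p c; \<forall>i\<in>fset \<Delta>. ineq_negative p i\<rbrakk>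
      \<Longrightarrow> pearl_rule (finsert (A \<preceq> Var p) \<Delta> \<tturnstile> c) [quasi_subst p A (\<Delta> \<tturnstile> c)]"
| ackermann_left:
    "\<lbrakk>PVar p \<notin> atoms A; ineq_negative p c; \<forall>i\<in>fset \<Gamma>. ineq_positive p i\<rbrakk>
      \<Longrightarrow> pearl_rule (finsert (Var p \<preceq> A) \<Gamma> \<tturnstile> c) [quasi_subst p A (\<Gamma> \<tturnstile> c)]"
| simplify_nominal:
    "Nom i \<notin> quasi_atoms (\<Gamma> \<tturnstile> A \<preceq> B)
      \<Longrightarrow> pearl_rule (finsert (Nm i \<preceq> A) \<Gamma> \<tturnstile> Nm i \<preceq> B) [\<Gamma> \<tturnstile> A \<preceq> B]"
| simplify_conominal:
    "CoNom m \<notin> quasi_atoms (\<Gamma> \<tturnstile> A \<preceq> B)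
      \<Longrightarrow> pearl_rule (finsert (B \<preceq> Cn m) \<Gamma> \<tturnstile> A \<preceq> Cn m) [\<Gamma> \<tturnstile> A \<preceq> B]"
| split_premise:
    "split_ineq i k l
      \<Longrightarrow> pearl_rule (finsert i \<Gamma> \<tturnstile> c) [finsert k (finsert l \<Gamma>) \<tturnstile> c]"
| split_consequent:
    "split_ineq c c1 c2 \<Longrightarrow> pearl_rule (\<Gamma> \<tturnstile> c) [\<Gamma> \<tturnstile> c1, \<Gamma> \<tturnstile> c2]"

inductive pearl_step :: "quasi list \<Rightarrow> quasi list \<Rightarrow> bool" where
  "pearl_rule q qs \<Longrightarrow> pearl_step (us @ q # vs) (us @ qs @ vs)"

fun pearl_start :: "rfm \<Rightarrow> quasi" where
  "pearl_start (RImp A B) = ({||} \<tturnstile> embed A \<preceq> embed B)"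
| "pearl_start A = ({||} \<tturnstile> Unit \<preceq> embed A)"

definition pearl_succeeds :: "rfm \<Rightarrow> bool"
  where "pearl_succeeds \<phi> \<longleftrightarrow>
    (\<exists>qs. pearl_step\<^sup>*\<^sup>* [pearl_start \<phi>] qs \<and> (\<forall>q\<in>set qs. pure_quasi q))"

end

theory Submission
  imports Defs
begin

text \<open>
  Every rule reflects validity in the perfect algebra, and every rule preserves admissible
  validity, i.e. validity for valuations that send the propositional variables into the image of
  the embedding (nominals and co-nominals still range over all completely irreducible elements).
  For pure quasi-inequalities the two notions agree, so canonicity follows by going down a run
  with admissible validity and up again with full validity.

  Only the Ackermann rules are delicate: the substituted formula denotes a closed (or open)
  element, which has to be approximated by clopen ones.  This works for the inequalities that
  occur in a run because their shapes obey an invariant, expressed by the levels below.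
  Premises that are not of the form closed \<open>\<le>\<close> open have a side that is a finite join of
  completely join-prime constants (or dually), and there continuity replaces compactness.
\<close>


section \<open>Perfect algebras\<close>

text \<open>Validity on the small algebra says exactly that the starting inequality holds when
  variables take values in the image of the embedding; hence the restricted notion on the way down.
  The rules follow no strategy: they come in any order, and residuation is also used backwards, so
  the invariant must survive each single rule, and residuation must respect it in both directions.
  This fixes the constants. The two levels of a premise share a budget of 6, split as 3+3
  (compactness) or as 2+4 or 1+5 (a prime side against a continuous one). Negation sets the fine
  scale, since moving it across an inequality must not change whether the budget is met. The
  sigma-clause is used for fusion of closed elements, the pi-clause for implication from closed to
  open ones; the opposite readings come from complete preservation of joins and meets. Residuals
  inherit approximation from the connective they are adjoint to. The one-element algebra has no
  completely irreducible elements, hence no proper valuations, and is treated apart.\<close>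

lemma cji_prime:
  fixes j :: "'b::complete_distrib_lattice"
  assumes "completely_join_irreducible j" "j \<le> Sup S"
  shows "\<exists>s\<in>S. j \<le> s"
proof -
  \<comment> \<open>Infinite distributivity makes j the join of its traces on S; irreducibility then
    makes j one of these traces.\<close>
  have "j = Sup (inf j ` S)"
    using assms(2) by (metis inf.absorb1 inf_Sup)
  then have "j \<in> inf j ` S"
    using assms(1) unfolding completely_join_irreducible_def by blast
  then show ?thesis
    by (metis imageE inf.cobounded2)
qed

lemma cmi_prime:
  fixes m :: "'b::complete_distrib_lattice"
  assumes "completely_meet_irreducible m" "Inf S \<le> m"
  shows "\<exists>s\<in>S. s \<le> m"
proof -
  have "m = Inf (sup m ` S)"
    using assms(2) by (metis sup.absorb1 sup_Inf)
  then have "m \<in> sup m ` S"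
    using assms(1) unfolding completely_meet_irreducible_def by blast
  then show ?thesis
    by (metis imageE sup.cobounded2)
qed

lemma le_via_cji:
  fixes x y :: "'b::perfect_relevant_algebra"
  assumes "\<And>j. completely_join_irreducible j \<Longrightarrow> j \<le> x \<Longrightarrow> j \<le> y"
  shows "x \<le> y"
  by (subst join_generated[of x]) (auto intro: Sup_least assms)

lemma le_via_cmi:
  fixes x y :: "'b::perfect_relevant_algebra"
  assumes "\<And>m. completely_meet_irreducible m \<Longrightarrow> y \<le> m \<Longrightarrow> x \<le> m"
  shows "x \<le> y"
  by (subst meet_generated[of y]) (auto intro: Inf_greatest assms)

lemma le_via_cji_cmi:
  fixes x y :: "'b::perfect_relevant_algebra"
  assumes "\<And>j m. completely_join_irreducible j \<Longrightarrow> completely_meet_irreducible m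
    \<Longrightarrow> j \<le> x \<Longrightarrow> y \<le> m \<Longrightarrow> j \<le> m"
  shows "x \<le> y"
  by (rule le_via_cji, rule le_via_cmi) (rule assms)

lemma fusion_mono:
  fixes a b c d :: "'b::relevant_algebra"
  assumes "a \<le> c" "b \<le> d"
  shows "fusion a b \<le> fusion c d"
proof -
  have "fusion c d = sup (fusion c b) (fusion c d)"
    using fusion_sup_right[of c b d] assms(2) by (simp add: sup.absorb2)
  moreover have "fusion c b = sup (fusion a b) (fusion c b)"
    using fusion_sup_left[of a c b] assms(1) by (simp add: sup.absorb2)
  ultimately show ?thesis
    by (metis sup.cobounded1 order_trans)
qed

lemma rimp_mono:
  fixes a b c d :: "'b::relevant_algebra"
  assumes "c \<le> a" "b \<le> d"
  shows "rimp a b \<le> rimp c d"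
proof -
  have "fusion (rimp a b) c \<le> fusion (rimp a b) a"
    using assms(1) by (intro fusion_mono) auto
  also have "\<dots> \<le> b"
    by (simp add: fusion_residual)
  also note assms(2)
  finally show ?thesis
    by (simp only: fusion_residual)
qed

lemma rneg_antimono:
  fixes a b :: "'b::relevant_algebra"
  assumes "a \<le> b"
  shows "rneg b \<le> rneg a"
proof -
  have "rneg b = inf (rneg a) (rneg b)"
    using rneg_sup[of a b] assms by (simp add: sup.absorb2)
  then show ?thesis
    by (metis inf.cobounded1)
qed

section \<open>Residuals as extremal solutions of their adjunctions\<close>

definition neg_flat :: "'b::perfect_relevant_algebra \<Rightarrow> 'b"
  where "neg_flat b = Inf {a. rneg a \<le> b}"

definition neg_sharp :: "'b::perfect_relevant_algebra \<Rightarrow> 'b"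
  where "neg_sharp a = Sup {b. a \<le> rneg b}"

definition heyting :: "'b::perfect_relevant_algebra \<Rightarrow> 'b \<Rightarrow> 'b"
  where "heyting b c = Sup {a. inf a b \<le> c}"

definition coheyting :: "'b::perfect_relevant_algebra \<Rightarrow> 'b \<Rightarrow> 'b"
  where "coheyting a b = Inf {c. a \<le> sup b c}"

definition tri_residual :: "'b::perfect_relevant_algebra \<Rightarrow> 'b \<Rightarrow> 'b"
  where "tri_residual a c = Sup {b. fusion a b \<le> c}"

text \<open>The defining infimum is itself a solution, because \<open>rneg\<close> turns it into a
  join of elements below b. The other residuals work alike, with infinite distributivity behind
  \<open>heyting\<close> and \<open>coheyting\<close>.\<close>

lemma neg_flat_adj: "neg_flat b \<le> a \<longleftrightarrow> rneg a \<le> b"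
proof
  assume "neg_flat b \<le> a"
  then have "rneg a \<le> rneg (neg_flat b)"
    by (rule rneg_antimono)
  also have "\<dots> \<le> b"
    unfolding neg_flat_def rneg_Inf by (auto intro: SUP_least)
  finally show "rneg a \<le> b" .
qed (auto simp: neg_flat_def intro: Inf_lower)

lemma neg_sharp_adj: "b \<le> neg_sharp a \<longleftrightarrow> a \<le> rneg b"
proof
  assume "b \<le> neg_sharp a"
  have "a \<le> rneg (neg_sharp a)"
    unfolding neg_sharp_def rneg_Sup by (auto intro: INF_greatest)
  also have "\<dots> \<le> rneg b"
    using \<open>b \<le> neg_sharp a\<close> by (rule rneg_antimono)
  finally show "a \<le> rneg b" .
qed (auto simp: neg_sharp_def intro: Sup_upper)

lemma heyting_adj: "a \<le> heyting b c \<longleftrightarrow> inf a b \<le> c"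
proof
  assume "a \<le> heyting b c"
  then have "inf a b \<le> inf (heyting b c) b"
    by (rule inf_mono) simp
  also have "\<dots> \<le> c"
    unfolding heyting_def Sup_inf by (auto intro: SUP_least)
  finally show "inf a b \<le> c" .
qed (auto simp: heyting_def intro: Sup_upper)

lemma coheyting_adj: "coheyting a b \<le> c \<longleftrightarrow> a \<le> sup b c"
proof
  assume "coheyting a b \<le> c"
  have "a \<le> sup b (coheyting a b)"
    unfolding coheyting_def sup_Inf by (auto intro: INF_greatest)
  also have "\<dots> \<le> sup b c"
    using \<open>coheyting a b \<le> c\<close> by (intro sup_mono) auto
  finally show "a \<le> sup b c" .
qed (auto simp: coheyting_def intro: Inf_lower)

lemma tri_residual_adj: "b \<le> tri_residual a c \<longleftrightarrow> fusion a b \<le> c"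
proof
  assume "b \<le> tri_residual a c"
  then have "fusion a b \<le> fusion a (tri_residual a c)"
    by (intro fusion_mono) auto
  also have "\<dots> \<le> c"
    unfolding tri_residual_def fusion_Sup_right by (auto intro: SUP_least)
  finally show "fusion a b \<le> c" .
qed (auto simp: tri_residual_def intro: Sup_upper)

lemma neg_flat_antimono: "a \<le> b \<Longrightarrow> neg_flat b \<le> neg_flat a"
  by (meson neg_flat_adj order_refl order_trans)

lemma neg_sharp_antimono: "a \<le> b \<Longrightarrow> neg_sharp b \<le> neg_sharp a"
  by (meson neg_sharp_adj order_refl order_trans)

lemma heyting_mono: "c \<le> a \<Longrightarrow> b \<le> d \<Longrightarrow> heyting a b \<le> heyting c d"
  by (meson heyting_adj inf_mono order_refl order_trans)

lemma coheyting_mono: "a \<le> c \<Longrightarrow> d \<le> b \<Longrightarrow> coheyting a b \<le> coheyting c d"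
  by (meson coheyting_adj sup_mono order_refl order_trans)

lemma tri_residual_mono: "c \<le> a \<Longrightarrow> b \<le> d \<Longrightarrow> tri_residual a b \<le> tri_residual c d"
  by (meson tri_residual_adj fusion_mono order_refl order_trans)

lemmas connective_monos = inf_mono sup_mono fusion_mono rimp_mono rneg_antimono
  neg_flat_antimono neg_sharp_antimono heyting_mono coheyting_mono tri_residual_mono

text \<open>Generation by irreducibles turns \<open>rimp x y\<close> into a meet, and m, being
  completely prime, picks a single member of it. The lemmas for fusion and negation follow the same
  pattern; they supply the values of the fresh atoms in the approximation rules.\<close>

lemma rimp_le_cmi:
  fixes x y m :: "'b::perfect_relevant_algebra"
  assumes "completely_meet_irreducible m" "rimp x y \<le> m"
  shows "\<exists>j. completely_join_irreducible j \<and> j \<le> x \<and> rimp j y \<le> m"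
    and "\<exists>n. completely_meet_irreducible n \<and> y \<le> n \<and> rimp x n \<le> m"
proof -
  have "Inf ((\<lambda>j. rimp j y) ` {j. completely_join_irreducible j \<and> j \<le> x}) \<le> m"
    using assms(2) by (subst (asm) join_generated[of x]) (simp add: rimp_Sup)
  from cmi_prime[OF assms(1) this]
  show "\<exists>j. completely_join_irreducible j \<and> j \<le> x \<and> rimp j y \<le> m" by auto
  have "Inf (rimp x ` {n. completely_meet_irreducible n \<and> y \<le> n}) \<le> m"
    using assms(2) by (subst (asm) meet_generated[of y]) (simp add: rimp_Inf)
  from cmi_prime[OF assms(1) this]
  show "\<exists>n. completely_meet_irreducible n \<and> y \<le> n \<and> rimp x n \<le> m" by auto
qed

lemma cji_le_fusion:
  fixes x y i :: "'b::perfect_relevant_algebra"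
  assumes "completely_join_irreducible i" "i \<le> fusion x y"
  shows "\<exists>j. completely_join_irreducible j \<and> j \<le> x \<and> i \<le> fusion j y"
    and "\<exists>j. completely_join_irreducible j \<and> j \<le> y \<and> i \<le> fusion x j"
proof -
  have "i \<le> Sup ((\<lambda>j. fusion j y) ` {j. completely_join_irreducible j \<and> j \<le> x})"
    using assms(2) by (subst (asm) join_generated[of x]) (simp add: fusion_Sup_left)
  from cji_prime[OF assms(1) this]
  show "\<exists>j. completely_join_irreducible j \<and> j \<le> x \<and> i \<le> fusion j y" by auto
  have "i \<le> Sup (fusion x ` {j. completely_join_irreducible j \<and> j \<le> y})"
    using assms(2) by (subst (asm) join_generated[of y]) (simp add: fusion_Sup_right)
  from cji_prime[OF assms(1) this]
  show "\<exists>j. completely_join_irreducible j \<and> j \<le> y \<and> i \<le> fusion x j" by auto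
qed

lemma rneg_le_cmi:
  fixes x m :: "'b::perfect_relevant_algebra"
  assumes "completely_meet_irreducible m" "rneg x \<le> m"
  shows "\<exists>j. completely_join_irreducible j \<and> j \<le> x \<and> rneg j \<le> m"
proof -
  have "Inf (rneg ` {j. completely_join_irreducible j \<and> j \<le> x}) \<le> m"
    using assms(2) by (subst (asm) join_generated[of x]) (simp add: rneg_Sup)
  from cmi_prime[OF assms(1) this] show ?thesis by auto
qed

lemma cji_le_rneg:
  fixes x i :: "'b::perfect_relevant_algebra"
  assumes "completely_join_irreducible i" "i \<le> rneg x"
  shows "\<exists>n. completely_meet_irreducible n \<and> x \<le> n \<and> i \<le> rneg n"
proof -
  have "i \<le> Sup (rneg ` {n. completely_meet_irreducible n \<and> x \<le> n})"
    using assms(2) by (subst (asm) meet_generated[of x]) (simp add: rneg_Inf)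
  from cji_prime[OF assms(1) this] show ?thesis by auto
qed


section \<open>Semantics of the extended language\<close>

primrec val :: "(atom \<Rightarrow> 'b::perfect_relevant_algebra) \<Rightarrow> fm \<Rightarrow> 'b" where
  "val w (At x) = w x"
| "val w Bot = bot"
| "val w Top = top"
| "val w Unit = runit"
| "val w (Neg A) = rneg (val w A)"
| "val w (And A B) = inf (val w A) (val w B)"
| "val w (Or A B) = sup (val w A) (val w B)"
| "val w (Fus A B) = fusion (val w A) (val w B)"
| "val w (Imp A B) = rimp (val w A) (val w B)"
| "val w (NegFlat A) = neg_flat (val w A)"
| "val w (NegSharp A) = neg_sharp (val w A)"
| "val w (HImp A B) = heyting (val w A) (val w B)"
| "val w (CoImp A B) = coheyting (val w A) (val w B)"
| "val w (Tri A B) = tri_residual (val w A) (val w B)"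

primrec sat :: "(atom \<Rightarrow> 'b::perfect_relevant_algebra) \<Rightarrow> ineq \<Rightarrow> bool" where
  "sat w (A \<preceq> B) \<longleftrightarrow> val w A \<le> val w B"

primrec qsat :: "(atom \<Rightarrow> 'b::perfect_relevant_algebra) \<Rightarrow> quasi \<Rightarrow> bool" where
  "qsat w (\<Gamma> \<tturnstile> c) \<longleftrightarrow> ((\<forall>i\<in>fset \<Gamma>. sat w i) \<longrightarrow> sat w c)"

lemma val_cong: "\<forall>x\<in>atoms A. w x = w' x \<Longrightarrow> val w A = val w' A"
  by (induction A) simp_all

lemma sat_cong: "\<forall>x\<in>ineq_atoms i. w x = w' x \<Longrightarrow> sat w i \<longleftrightarrow> sat w' i"
  by (cases i) (simp add: val_cong[of _ w w'])

lemma qsat_cong: "\<forall>x\<in>quasi_atoms q. w x = w' x \<Longrightarrow> qsat w q \<longleftrightarrow> qsat w' q"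
proof (cases q)
  case (Quasi \<Gamma> c)
  moreover assume "\<forall>x\<in>quasi_atoms q. w x = w' x"
  ultimately have "sat w c \<longleftrightarrow> sat w' c" "\<forall>i\<in>fset \<Gamma>. sat w i \<longleftrightarrow> sat w' i"
    by (auto intro!: sat_cong)
  with Quasi show ?thesis
    by simp
qed

lemma val_upd [simp]: "x \<notin> atoms A \<Longrightarrow> val (w(x := y)) A = val w A"
  by (rule val_cong) auto

lemma sat_upd [simp]: "x \<notin> ineq_atoms i \<Longrightarrow> sat (w(x := y)) i \<longleftrightarrow> sat w i"
  by (rule sat_cong) auto

lemma val_subst: "val w (subst p C A) = val (w(PVar p := val w C)) A"
  by (induction A) auto

lemma sat_subst: "sat w (ineq_subst p C i) \<longleftrightarrow> sat (w(PVar p := val w C)) i"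
  by (cases i) (simp add: val_subst)

lemma qsat_subst: "qsat w (quasi_subst p C q) \<longleftrightarrow> qsat (w(PVar p := val w C)) q"
  by (cases q) (auto simp: sat_subst)

text \<open>The order or its dual, chosen by a sign, so that closed and open elements can share one
  treatment later.\<close>

definition signed_le :: "bool \<Rightarrow> 'b::order \<Rightarrow> 'b \<Rightarrow> bool"
  where "signed_le s x y \<longleftrightarrow> (if s then x \<le> y else y \<le> x)"

lemma signed_le_simps [simp]:
  "signed_le True x y \<longleftrightarrow> x \<le> y" "signed_le False x y \<longleftrightarrow> y \<le> x"
  by (auto simp: signed_le_def)

lemma signed_le_refl [simp]: "signed_le s x x"
  by (simp add: signed_le_def)

lemma signed_le_trans: "signed_le s x y \<Longrightarrow> signed_le s y z \<Longrightarrow> signed_le s x z"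
  by (auto simp: signed_le_def split: if_splits)

lemma val_signed:
  assumes "x \<le> y" "signed s p A"
  shows "signed_le s (val (w(PVar p := x)) A) (val (w(PVar p := y)) A)"
proof -
  let ?x = "val (w(PVar p := x))" and ?y = "val (w(PVar p := y))"
  have "(signed True p A \<longrightarrow> ?x A \<le> ?y A) \<and> (signed False p A \<longrightarrow> ?y A \<le> ?x A)"
    using assms(1) by (induction A) (simp_all add: connective_monos le_infI1 le_infI2 le_supI1 le_supI2)
  with assms(2) show ?thesis
    by (cases s) auto
qed

lemma sat_positive:
  assumes "ineq_positive p i" "x \<le> y" "sat (w(PVar p := x)) i"
  shows "sat (w(PVar p := y)) i"
proof (cases i)
  case (Leq A B)
  then show ?thesis
    using assms val_signed[of x y False p A w] val_signed[of x y True p B w]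
    by (auto intro: order_trans)
qed

lemma sat_negative:
  assumes "ineq_negative p i" "x \<le> y" "sat (w(PVar p := y)) i"
  shows "sat (w(PVar p := x)) i"
proof (cases i)
  case (Leq A B)
  then show ?thesis
    using assms val_signed[of x y True p A w] val_signed[of x y False p B w]
    by (auto intro: order_trans)
qed

section \<open>Semantics of residuation, adjunction and splitting\<close>

lemma sat_residual: "residual i k \<Longrightarrow> sat w i \<longleftrightarrow> sat w k"
  by (induction rule: residual.induct)
    (simp_all add: coheyting_adj heyting_adj fusion_residual tri_residual_adj
      neg_flat_adj neg_sharp_adj inf.commute sup.commute)

lemma sat_adjunction: "adjunction i k l \<Longrightarrow> sat w i \<longleftrightarrow> sat w k \<and> sat w l"
  by (induction rule: adjunction.induct) auto

lemma rimp_sup_left: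
  fixes a b c :: "'b::perfect_relevant_algebra"
  shows "rimp (sup a b) c = inf (rimp a c) (rimp b c)"
  using rimp_Sup[of "{a, b}" c] by simp

lemma rimp_inf_right:
  fixes a b c :: "'b::perfect_relevant_algebra"
  shows "rimp a (inf b c) = inf (rimp a b) (rimp a c)"
  using rimp_Inf[of a "{b, c}"] by simp

lemma eq_by_upper_bounds: "(\<And>z. x \<le> z \<longleftrightarrow> y \<le> z) \<Longrightarrow> x = (y::'c::order)"
  by (simp add: order.eq_iff)

lemma eq_by_lower_bounds: "(\<And>z. z \<le> x \<longleftrightarrow> z \<le> y) \<Longrightarrow> x = (y::'c::order)"
  by (simp add: order.eq_iff)

text \<open>Left adjoints are compared through their upper bounds and right adjoints through their
  lower bounds, where the adjunction removes the residual.\<close>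

lemma residual_distribs:
  "neg_flat (inf a b) = sup (neg_flat a) (neg_flat b)"
  "coheyting (sup a b) c = sup (coheyting a c) (coheyting b c)"
  "coheyting a (inf b c) = sup (coheyting a b) (coheyting a c)"
  "neg_sharp (sup a b) = inf (neg_sharp a) (neg_sharp b)"
  "heyting (sup a b) c = inf (heyting a c) (heyting b c)"
  "heyting a (inf b c) = inf (heyting a b) (heyting a c)"
  "tri_residual (sup a b) c = inf (tri_residual a c) (tri_residual b c)"
  "tri_residual a (inf b c) = inf (tri_residual a b) (tri_residual a c)"
  by (rule eq_by_upper_bounds, simp add: neg_flat_adj coheyting_adj sup_inf_distrib2)+
    (rule eq_by_lower_bounds, simp add: neg_sharp_adj heyting_adj tri_residual_adj
      fusion_sup_left inf_sup_distrib1)+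

lemma val_split:
  "split_join A A1 A2 \<Longrightarrow> val w A = sup (val w A1) (val w A2)"
  "split_meet B B1 B2 \<Longrightarrow> val w B = inf (val w B1) (val w B2)"
  by (induction rule: split_join_split_meet.inducts)
    (simp_all add: fusion_sup_left fusion_sup_right rneg_sup rneg_inf rimp_sup_left
      rimp_inf_right residual_distribs,
     (rule inf_sup_distrib1 inf_sup_distrib2 sup_inf_distrib1 sup_inf_distrib2)+)

lemma sat_split: "split_ineq i k l \<Longrightarrow> sat w i \<longleftrightarrow> sat w k \<and> sat w l"
  by (induction rule: split_ineq.induct) (auto simp: val_split)


section \<open>Soundness of the rules\<close>

text \<open>\<open>False\<close> at propositional variables confines the closure condition of
  \<open>valuation_class\<close> to nominals and co-nominals, the only atoms that a rule introduces
  or discards as fresh.\<close>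

primrec pure_value :: "atom \<Rightarrow> 'b::perfect_relevant_algebra \<Rightarrow> bool" where
  "pure_value (PVar p) y \<longleftrightarrow> False"
| "pure_value (Nom j) y \<longleftrightarrow> completely_join_irreducible y"
| "pure_value (CoNom m) y \<longleftrightarrow> completely_meet_irreducible y"

definition proper :: "(atom \<Rightarrow> 'b::perfect_relevant_algebra) \<Rightarrow> bool"
  where "proper w \<longleftrightarrow> (\<forall>j. completely_join_irreducible (w (Nom j))) \<and>
    (\<forall>m. completely_meet_irreducible (w (CoNom m)))"

text \<open>What the rules with fresh atoms require of a set of valuations. Both the proper
  valuations and those with clopen variables qualify, so these rules are verified once for both
  directions of the argument.\<close>

definition valuation_class :: "((atom \<Rightarrow> 'b::perfect_relevant_algebra) \<Rightarrow> bool) \<Rightarrow> bool"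
  where "valuation_class V \<longleftrightarrow> (\<forall>w. V w \<longrightarrow> proper w) \<and>
    (\<forall>w x y. V w \<longrightarrow> pure_value x y \<longrightarrow> V (w(x := y)))"

definition qvalid :: "((atom \<Rightarrow> 'b::perfect_relevant_algebra) \<Rightarrow> bool) \<Rightarrow> quasi \<Rightarrow> bool"
  where "qvalid V q \<longleftrightarrow> (\<forall>w. V w \<longrightarrow> qsat w q)"

lemma valuation_class_proper: "valuation_class proper"
proof -
  have "proper (w(x := y))" if "proper w" "pure_value x y" for w x and y :: "'b::perfect_relevant_algebra"
    using that by (cases x) (auto simp: proper_def)
  then show ?thesis
    unfolding valuation_class_def by blast
qed

lemma approx_sound:
  assumes "approx x i k l" "sat w k" "sat w l"
  shows "sat w i"
  using assms
proof cases
  case (imp_fst j X A m)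
  then show ?thesis
    using assms rimp_mono[of "w (Nom j)" "val w X" "val w A" "val w A"] by simp
next
  case (imp_snd n X A m)
  then show ?thesis
    using assms rimp_mono[of "val w X" "val w X" "val w A" "w (CoNom n)"] by simp
next
  case (fus_fst j i X A)
  then show ?thesis
    using assms fusion_mono[of "w (Nom j)" "val w X" "val w A" "val w A"] by simp
next
  case (fus_snd j i X A)
  then show ?thesis
    using assms fusion_mono[of "val w X" "val w X" "w (Nom j)" "val w A"] by simp
next
  case (neg_left j A m)
  then show ?thesis
    using assms rneg_antimono[of "w (Nom j)" "val w A"] by simp
next
  case (neg_right n i A)
  then show ?thesis
    using assms rneg_antimono[of "val w A" "w (CoNom n)"] by simp
qed

text \<open>One side of i is a nominal or co-nominal, whose value is completely prime because w is
  proper; it picks the value of x. Freshness keeps the rest unchanged.\<close>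

lemma approx_complete:
  assumes "approx x i k l" "x \<notin> ineq_atoms i" "proper w" "sat w i"
  shows "\<exists>y. pure_value x y \<and> sat (w(x := y)) k \<and> sat (w(x := y)) l"
  using assms
proof cases
  case (imp_fst j X A m)
  then show ?thesis
    using assms rimp_le_cmi(1)[of "w (CoNom m)" "val w X" "val w A"] by (auto simp: proper_def)
next
  case (imp_snd n X A m)
  then show ?thesis
    using assms rimp_le_cmi(2)[of "w (CoNom m)" "val w X" "val w A"] by (auto simp: proper_def)
next
  case (fus_fst j i X A)
  then show ?thesis
    using assms cji_le_fusion(1)[of "w (Nom i)" "val w X" "val w A"] by (auto simp: proper_def)
next
  case (fus_snd j i X A)
  then show ?thesis
    using assms cji_le_fusion(2)[of "w (Nom i)" "val w X" "val w A"] by (auto simp: proper_def)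
next
  case (neg_left j A m)
  then show ?thesis
    using assms rneg_le_cmi[of "w (CoNom m)" "val w A"] by (auto simp: proper_def)
next
  case (neg_right n i A)
  then show ?thesis
    using assms cji_le_rneg[of "w (Nom i)" "val w A"] by (auto simp: proper_def)
qed

text \<open>The fresh atoms range over all irreducibles j below A and m above B, independently of
  \<Gamma>, and these decide whether A lies below B.\<close>

lemma qvalid_first_approximation:
  assumes V: "valuation_class V"
    and fresh: "Nom j \<notin> quasi_atoms (\<Gamma> \<tturnstile> A \<preceq> B)" "CoNom m \<notin> quasi_atoms (\<Gamma> \<tturnstile> A \<preceq> B)"
  shows "qvalid V (finsert (Nm j \<preceq> A) (finsert (B \<preceq> Cn m) \<Gamma>) \<tturnstile> Nm j \<preceq> Cn m)
    \<longleftrightarrow> qvalid V (\<Gamma> \<tturnstile> A \<preceq> B)" (is "?l \<longleftrightarrow> ?r")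
proof
  assume ?l
  show ?r
    unfolding qvalid_def
  proof (intro allI impI)
    fix w assume w: "V w"
    show "qsat w (\<Gamma> \<tturnstile> A \<preceq> B)"
      unfolding qsat.simps sat.simps
    proof (rule impI, rule le_via_cji_cmi)
      fix y z assume \<Gamma>: "\<forall>i\<in>fset \<Gamma>. sat w i"
        and yz: "completely_join_irreducible y" "completely_meet_irreducible z"
          "y \<le> val w A" "val w B \<le> z"
      let ?w = "w(Nom j := y, CoNom m := z)"
      have "V ?w"
        using V w yz unfolding valuation_class_def by (metis pure_value.simps(2,3))
      with \<open>?l\<close> have "qsat ?w (finsert (Nm j \<preceq> A) (finsert (B \<preceq> Cn m) \<Gamma>) \<tturnstile> Nm j \<preceq> Cn m)"
        unfolding qvalid_def by blast
      moreover have "\<forall>i\<in>fset \<Gamma>. sat ?w i"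
        using \<Gamma> fresh by simp
      ultimately show "y \<le> z"
        using fresh yz by simp
    qed
  qed
qed (simp add: qvalid_def, meson order_trans)

lemma qvalid_approximation:
  assumes V: "valuation_class V" and "approx x i k l"
    and fresh: "x \<notin> quasi_atoms (finsert i \<Gamma> \<tturnstile> c)"
  shows "qvalid V (finsert k (finsert l \<Gamma>) \<tturnstile> c) \<longleftrightarrow> qvalid V (finsert i \<Gamma> \<tturnstile> c)" (is "?l \<longleftrightarrow> ?r")
proof
  assume ?l
  show ?r
    unfolding qvalid_def
  proof (intro allI impI)
    fix w assume w: "V w"
    show "qsat w (finsert i \<Gamma> \<tturnstile> c)"
      unfolding qsat.simps
    proof (intro impI)
      assume \<Gamma>: "\<forall>i\<in>fset (finsert i \<Gamma>). sat w i"
      obtain y where y: "pure_value x y" "sat (w(x := y)) k" "sat (w(x := y)) l"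
        using approx_complete[OF assms(2), of w] fresh w V \<Gamma> by (auto simp: valuation_class_def)
      have "V (w(x := y))"
        using V w y unfolding valuation_class_def by (metis pure_value.simps(2,3))
      then have "qsat (w(x := y)) (finsert k (finsert l \<Gamma>) \<tturnstile> c)"
        using \<open>?l\<close> unfolding qvalid_def by blast
      moreover have "\<forall>i\<in>fset \<Gamma>. sat (w(x := y)) i"
        using \<Gamma> fresh by simp
      ultimately show "sat w c"
        using y fresh by simp
    qed
  qed
qed (auto simp: qvalid_def dest: approx_sound[OF assms(2)])

lemma qvalid_simplify_nominal:
  assumes V: "valuation_class V" and fresh: "Nom i \<notin> quasi_atoms (\<Gamma> \<tturnstile> A \<preceq> B)"
  shows "qvalid V (finsert (Nm i \<preceq> A) \<Gamma> \<tturnstile> Nm i \<preceq> B) \<longleftrightarrow> qvalid V (\<Gamma> \<tturnstile> A \<preceq> B)"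
    (is "?l \<longleftrightarrow> ?r")
proof
  assume ?l
  show ?r
    unfolding qvalid_def qsat.simps sat.simps
  proof (intro allI impI, rule le_via_cji)
    fix w y assume w: "V w" and \<Gamma>: "\<forall>i\<in>fset \<Gamma>. sat w i"
      and y: "completely_join_irreducible y" "y \<le> val w A"
    have "V (w(Nom i := y))"
      using V w y unfolding valuation_class_def by (metis pure_value.simps(2,3))
    then have "qsat (w(Nom i := y)) (finsert (Nm i \<preceq> A) \<Gamma> \<tturnstile> Nm i \<preceq> B)"
      using \<open>?l\<close> unfolding qvalid_def by blast
    moreover have "\<forall>k\<in>fset \<Gamma>. sat (w(Nom i := y)) k"
      using \<Gamma> fresh by simp
    ultimately show "y \<le> val w B"
      using fresh y by simp
  qed
qed (simp add: qvalid_def, meson order_trans)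

lemma qvalid_simplify_conominal:
  assumes V: "valuation_class V" and fresh: "CoNom m \<notin> quasi_atoms (\<Gamma> \<tturnstile> A \<preceq> B)"
  shows "qvalid V (finsert (B \<preceq> Cn m) \<Gamma> \<tturnstile> A \<preceq> Cn m) \<longleftrightarrow> qvalid V (\<Gamma> \<tturnstile> A \<preceq> B)"
    (is "?l \<longleftrightarrow> ?r")
proof
  assume ?l
  show ?r
    unfolding qvalid_def qsat.simps sat.simps
  proof (intro allI impI, rule le_via_cmi)
    fix w y assume w: "V w" and \<Gamma>: "\<forall>i\<in>fset \<Gamma>. sat w i"
      and y: "completely_meet_irreducible y" "val w B \<le> y"
    have "V (w(CoNom m := y))"
      using V w y unfolding valuation_class_def by (metis pure_value.simps(2,3))
    then have "qsat (w(CoNom m := y)) (finsert (B \<preceq> Cn m) \<Gamma> \<tturnstile> A \<preceq> Cn m)"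
      using \<open>?l\<close> unfolding qvalid_def by blast
    moreover have "\<forall>k\<in>fset \<Gamma>. sat (w(CoNom m := y)) k"
      using \<Gamma> fresh by simp
    ultimately show "val w A \<le> y"
      using fresh y by simp
  qed
qed (simp add: qvalid_def, meson order_trans)

lemma proper_upd_var: "proper w \<Longrightarrow> proper (w(PVar p := y))"
  by (simp add: proper_def)

lemma pearl_rule_reflects_validity:
  assumes rule: "pearl_rule q qs" and valid: "\<forall>q'\<in>set qs. qvalid (proper :: (atom \<Rightarrow> 'b::perfect_relevant_algebra) \<Rightarrow> bool) q'"
  shows "qvalid (proper :: (atom \<Rightarrow> 'b) \<Rightarrow> bool) q"
  using rule
proof cases
  case (mono_bot p c \<Gamma>)
  show ?thesis
    unfolding qvalid_def mono_bot(1) qsat.simps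
  proof (intro allI impI)
    fix w :: "atom \<Rightarrow> 'b" assume w: "proper w" "\<forall>i\<in>fset \<Gamma>. sat w i"
    \<comment> \<open>\<open>bot\<close> is the least favourable value: lowering p keeps the
      negative premises, and raising it again keeps the positive consequent.\<close>
    have "\<forall>i\<in>fset \<Gamma>. sat (w(PVar p := bot)) i"
      using w mono_bot sat_negative[of p _ bot "w (PVar p)" w] by auto
    moreover have "qsat (w(PVar p := bot)) (\<Gamma> \<tturnstile> c)"
      using valid w mono_bot by (auto simp: qvalid_def qsat_subst simp del: quasi_subst.simps qsat.simps)
    ultimately have "sat (w(PVar p := bot)) c"
      by simp
    then show "sat w c"
      using mono_bot sat_positive[of p c bot "w (PVar p)" w] by simp
  qed
next
  case (mono_top p c \<Gamma>)
  show ?thesis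
    unfolding qvalid_def mono_top(1) qsat.simps
  proof (intro allI impI)
    fix w :: "atom \<Rightarrow> 'b" assume w: "proper w" "\<forall>i\<in>fset \<Gamma>. sat w i"
    have "\<forall>i\<in>fset \<Gamma>. sat (w(PVar p := top)) i"
      using w mono_top sat_positive[of p _ "w (PVar p)" top w] by auto
    moreover have "qsat (w(PVar p := top)) (\<Gamma> \<tturnstile> c)"
      using valid w mono_top by (auto simp: qvalid_def qsat_subst simp del: quasi_subst.simps qsat.simps)
    ultimately have "sat (w(PVar p := top)) c"
      by simp
    then show "sat w c"
      using mono_top sat_negative[of p c "w (PVar p)" top w] by simp
  qed
next
  case (ackermann_right p A c \<Delta>)
  show ?thesis
    unfolding qvalid_def ackermann_right(1) qsat.simps
  proof (intro allI impI)
    fix w :: "atom \<Rightarrow> 'b" assume w: "proper w" "\<forall>i\<in>fset (finsert (A \<preceq> Var p) \<Delta>). sat w i"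
    let ?w = "w(PVar p := val w A)"
    \<comment> \<open>The premise \<open>A \<preceq> Var p\<close> says that \<open>val w A\<close>
      lies below the present value of p. Moving p down to it keeps the negative premises; moving
      back up keeps the positive consequent.\<close>
    have "\<forall>i\<in>fset \<Delta>. sat ?w i"
      using w ackermann_right sat_negative[of p _ "val w A" "w (PVar p)" w] by auto
    moreover have "qsat ?w (\<Delta> \<tturnstile> c)"
      using valid w ackermann_right
      by (auto simp: qvalid_def qsat_subst simp del: quasi_subst.simps qsat.simps)
    ultimately have "sat ?w c"
      by simp
    then show "sat w c"
      using w ackermann_right sat_positive[of p c "val w A" "w (PVar p)" w] by simp
  qed
next
  case (ackermann_left p A c \<Gamma>)
  show ?thesis
    unfolding qvalid_def ackermann_left(1) qsat.simps
  proof (intro allI impI)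
    fix w :: "atom \<Rightarrow> 'b" assume w: "proper w" "\<forall>i\<in>fset (finsert (Var p \<preceq> A) \<Gamma>). sat w i"
    let ?w = "w(PVar p := val w A)"
    have "\<forall>i\<in>fset \<Gamma>. sat ?w i"
      using w ackermann_left sat_positive[of p _ "w (PVar p)" "val w A" w] by auto
    moreover have "qsat ?w (\<Gamma> \<tturnstile> c)"
      using valid w ackermann_left
      by (auto simp: qvalid_def qsat_subst simp del: quasi_subst.simps qsat.simps)
    ultimately have "sat ?w c"
      by simp
    then show "sat w c"
      using w ackermann_left sat_negative[of p c "w (PVar p)" "val w A" w] by simp
  qed
next
  case (first_approximation j \<Gamma> A B m)
  then show ?thesis
    using valid by (simp add: qvalid_first_approximation[OF valuation_class_proper] del: quasi_atoms.simps)
next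
  case (approximation x i k l \<Gamma> c)
  then show ?thesis
    using valid by (simp add: qvalid_approximation[OF valuation_class_proper] del: quasi_atoms.simps)
next
  case (simplify_nominal i \<Gamma> A B)
  then show ?thesis
    using valid by (simp add: qvalid_simplify_nominal[OF valuation_class_proper] del: quasi_atoms.simps)
next
  case (simplify_conominal m \<Gamma> A B)
  then show ?thesis
    using valid by (simp add: qvalid_simplify_conominal[OF valuation_class_proper] del: quasi_atoms.simps)
qed (use valid in \<open>auto simp: qvalid_def sat_residual sat_adjunction sat_split\<close>)


section \<open>Levels of formulas\<close>

text \<open>The value 6 records a loss of all information: every level is at least 1, so 6 never
  fits into the budget of a premise.\<close>

definition closed_cap :: "nat \<Rightarrow> nat \<Rightarrow> nat"
  where "closed_cap a b = (if a \<le> 3 \<and> b \<le> 3 then 3 else 6)"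

text \<open>The step from 4 to 5 is matched to \<open>residual_cap\<close>: against a formula of
  level 1, \<open>Neg A\<close> must be admissible exactly when the residual negation of that
  formula, of level 2, is admissible against A, and 2 leaves room for 4 but not for 5.\<close>

definition continuous_cap :: "nat \<Rightarrow> nat \<Rightarrow> nat"
  where "continuous_cap a b = (if a \<le> 3 \<and> b \<le> 3 then 3 else if a \<le> 4 \<and> b \<le> 4 then 5 else 6)"

text \<open>Residual negations exchange completely meet-prime and join-prime elements:
  \<open>neg_flat m \<le> Sup S\<close> says that the meet of all \<open>rneg s\<close> is below m.
  So level 1 leads to 2 and not to 3.\<close>

definition residual_cap :: "nat \<Rightarrow> nat"
  where "residual_cap a = (if a \<le> 1 then 2 else if a \<le> 3 then 3 else 6)"

text \<open>
  The sign says on which side of an inequality the formula stands: True for the left.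
  In the left reading, levels 1 and 2 are joins of completely join-prime constants, level 3
  is a closed element, level 4 allows co-nominals on top of that, level 5 is only continuous
  along filtered meets, and level 6 is unconstrained.  The right reading is dual.  Residuation
  moves subformulas between the sides without increasing the sum of the two levels beyond 6,
  which is what makes this bookkeeping an invariant; a mere closed/open distinction is not,
  because approximation leaves nominals in places where closed elements are not allowed.
\<close>

primrec level :: "bool \<Rightarrow> fm \<Rightarrow> nat" where
  "level s (At x) = (case x of PVar p \<Rightarrow> 3 | Nom j \<Rightarrow> if s then 1 else 4
    | CoNom m \<Rightarrow> if s then 4 else 1)"
| "level s Bot = 3"
| "level s Top = 3"
| "level s Unit = 3"
| "level s (Neg A) = continuous_cap (level (\<not> s) A) (level (\<not> s) A)"
| "level s (And A B) =
    (if s then closed_cap (level s A) (level s B) else max (level s A) (level s B))"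
| "level s (Or A B) =
    (if s then max (level s A) (level s B) else closed_cap (level s A) (level s B))"
| "level s (Fus A B) =
    (if s then closed_cap (level s A) (level s B) else continuous_cap (level s A) (level s B))"
| "level s (Imp A B) =
    (if s then continuous_cap (level (\<not> s) A) (level s B)
     else closed_cap (level (\<not> s) A) (level s B))"
| "level s (NegFlat A) =
    (if s then residual_cap (level (\<not> s) A) else 6)"
| "level s (NegSharp A) =
    (if s then 6 else residual_cap (level (\<not> s) A))"
| "level s (HImp A B) = (if s then 6 else closed_cap (level (\<not> s) A) (level s B))"
| "level s (CoImp A B) = (if s then closed_cap (level s A) (level (\<not> s) B) else 6)"
| "level s (Tri A B) = (if s then 6 else closed_cap (level (\<not> s) A) (level s B))"

primrec admissible_premise :: "ineq \<Rightarrow> bool" where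
  "admissible_premise (A \<preceq> B) \<longleftrightarrow> level True A + level False B \<le> 6"

text \<open>The signs are opposite to those in a premise, because failure of the consequent is
  detected by a nominal below A and a co-nominal above B. The bound is 6 - 1: first approximation
  and simplification exchange the consequent with premises whose other side has level 1.\<close>

primrec admissible_consequent :: "ineq \<Rightarrow> bool" where
  "admissible_consequent (A \<preceq> B) \<longleftrightarrow> level False A \<le> 5 \<and> level True B \<le> 5"

primrec admissible_quasi :: "quasi \<Rightarrow> bool" where
  "admissible_quasi (\<Gamma> \<tturnstile> c) \<longleftrightarrow> (\<forall>i\<in>fset \<Gamma>. admissible_premise i) \<and> admissible_consequent c"

lemma closed_cap_le_3 [simp]: "closed_cap a b \<le> 3 \<longleftrightarrow> a \<le> 3 \<and> b \<le> 3"
  by (simp add: closed_cap_def)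

lemma closed_cap_mono: "a \<le> a' \<Longrightarrow> b \<le> b' \<Longrightarrow> closed_cap a b \<le> closed_cap a' b'"
  by (auto simp: closed_cap_def)

lemma continuous_cap_le_3 [simp]: "continuous_cap a b \<le> 3 \<longleftrightarrow> a \<le> 3 \<and> b \<le> 3"
  by (simp add: continuous_cap_def)

lemma continuous_cap_mono: "a \<le> a' \<Longrightarrow> b \<le> b' \<Longrightarrow> continuous_cap a b \<le> continuous_cap a' b'"
  by (auto simp: continuous_cap_def)

lemma residual_cap_le_3 [simp]: "residual_cap a \<le> 3 \<longleftrightarrow> a \<le> 3"
  by (simp add: residual_cap_def)

lemma residual_cap_mono: "a \<le> a' \<Longrightarrow> residual_cap a \<le> residual_cap a'"
  by (auto simp: residual_cap_def)

lemmas cap_defs = closed_cap_def continuous_cap_def residual_cap_def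
lemmas cap_monos = closed_cap_mono continuous_cap_mono residual_cap_mono max.mono

lemma level_bounds: "1 \<le> level s A \<and> level s A \<le> 6"
  by (induction A arbitrary: s) (auto simp: cap_defs le_max_iff_disj split: atom.split)

lemma level_pos: "1 \<le> level s A"
  using level_bounds by blast

lemma level_le_closed_cap:
  "level s A \<le> closed_cap (level s A) b" "level s A \<le> closed_cap b (level s A)"
  using level_bounds[of s A] by (auto simp: closed_cap_def)

text \<open>3 is reproduced by every cap and by \<open>max\<close>; other levels arise only from
  nominals, co-nominals and residuals.\<close>

lemma level_embed: "level s (embed A) = 3"
  by (induction A arbitrary: s) (simp_all add: cap_defs)

text \<open>By polarity every occurrence of p is read with sign \<sigma>, where p has level 3 and C
  at most that; caps and \<open>max\<close> are monotone.\<close>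

lemma level_subst:
  assumes "level \<sigma> C \<le> 3" "signed (s = \<sigma>) p A"
  shows "level s (subst p C A) \<le> level s A"
proof -
  have "(signed (True = \<sigma>) p A \<longrightarrow> level True (subst p C A) \<le> level True A) \<and>
    (signed (False = \<sigma>) p A \<longrightarrow> level False (subst p C A) \<le> level False A)"
  proof (induction A)
    case (At x)
    then show ?case
      using assms(1) by (cases \<sigma>) auto
  qed (simp_all add: cap_monos del: max.bounded_iff)
  with assms(2) show ?thesis
    by (cases s) auto
qed

lemma level_split_aux:
  fixes A A1 A2 B B1 B2 :: fm
  shows
  "split_join A A1 A2 \<Longrightarrow> (level True A1 \<le> level True A \<and> level False A1 \<le> level False A) \<and>
    (level True A2 \<le> level True A \<and> level False A2 \<le> level False A)"
  "split_meet B B1 B2 \<Longrightarrow> (level True B1 \<le> level True B \<and> level False B1 \<le> level False B) \<and>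
    (level True B2 \<le> level True B \<and> level False B2 \<le> level False B)"
  by (induction rule: split_join_split_meet.inducts)
    (simp_all add: cap_monos level_le_closed_cap del: max.bounded_iff)

lemma level_split:
  "split_join A A1 A2 \<Longrightarrow> level s A1 \<le> level s A \<and> level s A2 \<le> level s A"
  "split_meet A A1 A2 \<Longrightarrow> level s A1 \<le> level s A \<and> level s A2 \<le> level s A"
  using level_split_aux[of A A1 A2] level_split_aux(2)[of A A1 A2] by (cases s; simp)+

text \<open>For binary connectives both sides say that all three formulas have level at most 3. Only
  negation uses the finer scale: if its argument has level 4, the split 5+1 before residuation
  becomes 2+4 after it.\<close>

lemma residual_admissible:
  "residual i k \<Longrightarrow> admissible_premise i \<longleftrightarrow> admissible_premise k"
proof (induction rule: residual.induct)
  case (coimp A B C)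
  then show ?case
    using level_pos[of True A] level_pos[of False C] by (auto simp: cap_defs split: if_splits)
next
  case (coimp_comm A B C)
  then show ?case
    using level_pos[of True A] level_pos[of False B] by (auto simp: cap_defs split: if_splits)
next
  case (himp A B C)
  then show ?case
    using level_pos[of True A] level_pos[of False C] by (auto simp: cap_defs split: if_splits)
next
  case (himp_comm A B C)
  then show ?case
    using level_pos[of True B] level_pos[of False C] by (auto simp: cap_defs split: if_splits)
next
  case (imp A B C)
  then show ?case
    using level_pos[of True A] level_pos[of False C] by (auto simp: cap_defs split: if_splits)
next
  case (tri B A C)
  then show ?case
    using level_pos[of True B] level_pos[of False C] by (auto simp: cap_defs split: if_splits)
next
  case (neg_flat A B)
  then show ?case
    using level_pos[of False A] level_pos[of False B] by (auto simp: cap_defs split: if_splits)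
next
  case (neg_sharp A B)
  then show ?case
    using level_pos[of True A] level_pos[of True B] by (auto simp: cap_defs split: if_splits)
qed

lemma approx_admissible:
  "approx x i k l \<Longrightarrow> admissible_premise i \<Longrightarrow> admissible_premise k \<and> admissible_premise l"
  by (induction rule: approx.induct) (auto simp: cap_defs split: if_splits)

lemma adjunction_admissible:
  "adjunction i k l \<Longrightarrow> admissible_premise i \<longleftrightarrow> admissible_premise k \<and> admissible_premise l"
  by (induction rule: adjunction.induct) auto

lemma split_admissible:
  assumes "split_ineq i k l"
  shows "admissible_premise i \<Longrightarrow> admissible_premise k \<and> admissible_premise l"
    and "admissible_consequent i \<Longrightarrow> admissible_consequent k \<and> admissible_consequent l"
  using assms by (cases; fastforce dest: level_split(1)[where s = True] level_split(1)[where s = False]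
    level_split(2)[where s = True] level_split(2)[where s = False])+

lemma subst_admissible_premise:
  assumes "level \<sigma> C \<le> 3" "ineq_signed (\<not> \<sigma>) p i" "admissible_premise i"
  shows "admissible_premise (ineq_subst p C i)"
  using assms level_subst[of \<sigma> C True p] level_subst[of \<sigma> C False p]
  by (cases i; cases \<sigma>) (fastforce dest: add_mono)+

lemma subst_admissible_consequent:
  assumes "level \<sigma> C \<le> 3" "ineq_signed \<sigma> p i" "admissible_consequent i"
  shows "admissible_consequent (ineq_subst p C i)"
  using assms level_subst[of \<sigma> C True p] level_subst[of \<sigma> C False p]
  by (cases i; cases \<sigma>) (fastforce intro: order_trans)+

lemma subst_admissible_quasi:
  assumes "level \<sigma> C \<le> 3" "ineq_signed \<sigma> p c" "\<forall>i\<in>fset \<Gamma>. ineq_signed (\<not> \<sigma>) p i"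
    "admissible_quasi (\<Gamma> \<tturnstile> c)"
  shows "admissible_quasi (quasi_subst p C (\<Gamma> \<tturnstile> c))"
  using assms by (auto intro: subst_admissible_premise subst_admissible_consequent)

lemma pearl_rule_admissible:
  assumes "pearl_rule q qs" "admissible_quasi q"
  shows "\<forall>q'\<in>set qs. admissible_quasi q'"
  using assms
proof cases
  case (mono_bot p c \<Gamma>)
  then show ?thesis
    using assms(2) subst_admissible_quasi[of True Bot p c \<Gamma>] by simp
next
  case (mono_top p c \<Gamma>)
  then show ?thesis
    using assms(2) subst_admissible_quasi[of False Top p c \<Gamma>] by simp
next
  \<comment> \<open>Admissibility of \<open>A \<preceq> Var p\<close> gives level at most 3 to A,
    since a variable has level 3; this is what substitution requires.\<close>
  case (ackermann_right p A c \<Delta>)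
  then show ?thesis
    using assms(2) subst_admissible_quasi[of True A p c \<Delta>] by simp
next
  case (ackermann_left p A c \<Gamma>)
  then show ?thesis
    using assms(2) subst_admissible_quasi[of False A p c \<Gamma>] by simp
qed (use assms(2) in \<open>auto simp: residual_admissible adjunction_admissible
  dest: approx_admissible split_admissible\<close>)


section \<open>Closed and open elements of a canonical extension\<close>

locale canonical =
  fixes e :: "'a::relevant_algebra \<Rightarrow> 'b::perfect_relevant_algebra"
  assumes canonical: "canonical_extension e"
begin

lemma e_hom [simp]:
  "e (inf a b) = inf (e a) (e b)" "e (sup a b) = sup (e a) (e b)"
  "e (fusion a b) = fusion (e a) (e b)" "e (rimp a b) = rimp (e a) (e b)"
  "e (rneg a) = rneg (e a)" "e runit = runit" "e top = top" "e bot = bot"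
  using canonical by (simp_all add: canonical_extension_def relevant_embedding_def)

lemma e_mono: "a \<le> b \<Longrightarrow> e a \<le> e b"
  by (metis e_hom(1) le_iff_inf)

definition topological :: "bool \<Rightarrow> 'b \<Rightarrow> bool"
  where "topological s x \<longleftrightarrow> (if s then closed_element e x else open_element e x)"

lemma topological_e [simp]: "topological s (e a)"
  unfolding topological_def closed_element_def open_element_def
  by (auto intro: exI[of _ "{a}"])

lemma closed_eq: "topological True k \<Longrightarrow> k = Inf (e ` {a. k \<le> e a})"
  unfolding topological_def closed_element_def
  by (auto intro!: antisym INF_greatest intro: INF_superset_mono INF_lower)

lemma open_eq: "topological False u \<Longrightarrow> u = Sup (e ` {a. e a \<le> u})"
  unfolding topological_def open_element_def
  by (auto intro!: antisym SUP_least intro: SUP_subset_mono SUP_upper)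

lemma le_via_open:
  assumes "\<And>u. topological False u \<Longrightarrow> y \<le> u \<Longrightarrow> x \<le> u"
  shows "x \<le> y"
proof -
  obtain U where "\<forall>u\<in>U. open_element e u" "y = Inf U"
    using canonical unfolding canonical_extension_def dense_map_def by blast
  then show ?thesis
    using assms by (auto simp: topological_def intro: Inf_greatest Inf_lower)
qed

lemma le_via_closed:
  assumes "\<And>k. topological True k \<Longrightarrow> k \<le> x \<Longrightarrow> k \<le> y"
  shows "x \<le> y"
proof -
  obtain K where "\<forall>k\<in>K. closed_element e k" "x = Sup K"
    using canonical unfolding canonical_extension_def dense_map_def by blast
  then show ?thesis
    using assms by (auto simp: topological_def intro: Sup_least Sup_upper)
qed

text \<open>Density writes m as a meet of open elements, and irreducibility makes m one of
  them.\<close>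

lemma cmi_open:
  assumes "completely_meet_irreducible m"
  shows "topological False m"
proof -
  obtain U where "\<forall>u\<in>U. open_element e u" "m = Inf U"
    using canonical unfolding canonical_extension_def dense_map_def by blast
  then show ?thesis
    using assms unfolding completely_meet_irreducible_def topological_def by auto
qed

lemma cji_closed:
  assumes "completely_join_irreducible j"
  shows "topological True j"
proof -
  obtain K where "\<forall>k\<in>K. closed_element e k" "j = Sup K"
    using canonical unfolding canonical_extension_def dense_map_def by blast
  then show ?thesis
    using assms unfolding completely_join_irreducible_def topological_def by auto
qed

section \<open>Compactness for directed families\<close>

lemma finite_Inf_image:
  assumes "finite S" "S \<subseteq> T" "T \<noteq> {}" "\<And>a b. a \<in> T \<Longrightarrow> b \<in> T \<Longrightarrow> \<exists>c\<in>T. e c \<le> e a \<and> e c \<le> e b"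
  shows "\<exists>c\<in>T. e c \<le> Inf (e ` S)"
  using assms(1,2)
proof induction
  case empty
  then show ?case using assms(3) by auto
next
  case (insert a S)
  then obtain c where c: "c \<in> T" "e c \<le> Inf (e ` S)" by auto
  obtain d where "d \<in> T" "e d \<le> e c" "e d \<le> e a"
    using assms(4)[OF c(1), of a] insert by auto
  with c show ?case by (auto intro!: bexI[of _ d] elim: order_trans)
qed

lemma finite_Sup_image:
  assumes "finite S" "S \<subseteq> T" "T \<noteq> {}" "\<And>a b. a \<in> T \<Longrightarrow> b \<in> T \<Longrightarrow> \<exists>c\<in>T. e a \<le> e c \<and> e b \<le> e c"
  shows "\<exists>c\<in>T. Sup (e ` S) \<le> e c"
  using assms(1,2)
proof induction
  case empty
  then show ?case using assms(3) by auto
next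
  case (insert a S)
  then obtain c where c: "c \<in> T" "Sup (e ` S) \<le> e c" by auto
  obtain d where "d \<in> T" "e c \<le> e d" "e a \<le> e d"
    using assms(4)[OF c(1), of a] insert by auto
  with c show ?case by (auto intro!: bexI[of _ d] elim: order_trans)
qed

text \<open>Directedness replaces the finite subfamilies by single members; nonemptiness takes care
  of empty subfamilies.\<close>

lemma compactness:
  assumes "Inf (e ` S) \<le> Sup (e ` T)"
    and S: "S \<noteq> {}" "\<And>a b. a \<in> S \<Longrightarrow> b \<in> S \<Longrightarrow> \<exists>c\<in>S. e c \<le> e a \<and> e c \<le> e b"
    and T: "T \<noteq> {}" "\<And>a b. a \<in> T \<Longrightarrow> b \<in> T \<Longrightarrow> \<exists>c\<in>T. e a \<le> e c \<and> e b \<le> e c"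
  shows "\<exists>a\<in>S. \<exists>b\<in>T. e a \<le> e b"
proof -
  obtain S' T' where *: "finite S'" "S' \<subseteq> S" "finite T'" "T' \<subseteq> T" "Inf (e ` S') \<le> Sup (e ` T')"
    using canonical assms(1) unfolding canonical_extension_def compact_map_def by metis
  obtain a where "a \<in> S" "e a \<le> Inf (e ` S')"
    using finite_Inf_image[OF *(1,2) S] by auto
  moreover obtain b where "b \<in> T" "Sup (e ` T') \<le> e b"
    using finite_Sup_image[OF *(3,4) T] by auto
  ultimately show ?thesis
    using *(5) by (meson order_trans)
qed

lemma filtered_le_open:
  assumes "topological False u" "Inf (e ` S) \<le> u" "S \<noteq> {}"
    "\<And>a b. a \<in> S \<Longrightarrow> b \<in> S \<Longrightarrow> \<exists>c\<in>S. e c \<le> e a \<and> e c \<le> e b"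
  shows "\<exists>a\<in>S. e a \<le> u"
proof -
  let ?T = "{a. e a \<le> u}"
  have "\<exists>a\<in>S. \<exists>b\<in>?T. e a \<le> e b"
  proof (rule compactness)
    show "Inf (e ` S) \<le> Sup (e ` ?T)"
      using assms(2) open_eq[OF assms(1)] by simp
    show "?T \<noteq> {}"
      using e_hom(8) by (metis (mono_tags) bot_least empty_Collect_eq)
    show "\<exists>c\<in>?T. e a \<le> e c \<and> e b \<le> e c" if "a \<in> ?T" "b \<in> ?T" for a b
      using that by (auto intro!: exI[of _ "sup a b"])
  qed (use assms in auto)
  then show ?thesis
    by (auto elim: order_trans)
qed

lemma closed_le_directed:
  assumes "topological True k" "k \<le> Sup (e ` T)" "T \<noteq> {}"
    "\<And>a b. a \<in> T \<Longrightarrow> b \<in> T \<Longrightarrow> \<exists>c\<in>T. e a \<le> e c \<and> e b \<le> e c"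
  shows "\<exists>a\<in>T. k \<le> e a"
proof -
  let ?S = "{a. k \<le> e a}"
  have "\<exists>a\<in>?S. \<exists>b\<in>T. e a \<le> e b"
  proof (rule compactness)
    show "Inf (e ` ?S) \<le> Sup (e ` T)"
      using assms(2) closed_eq[OF assms(1)] by simp
    show "?S \<noteq> {}"
      using e_hom(7) by (metis (mono_tags) top_greatest empty_Collect_eq)
    show "\<exists>c\<in>?S. e c \<le> e a \<and> e c \<le> e b" if "a \<in> ?S" "b \<in> ?S" for a b
      using that by (auto intro!: exI[of _ "inf a b"])
  qed (use assms in auto)
  then show ?thesis
    by (auto intro: order_trans)
qed

lemma interpolate:
  assumes "topological True k" "topological False u" "k \<le> u"
  shows "\<exists>a. k \<le> e a \<and> e a \<le> u"
proof -
  have "\<exists>a\<in>{a. k \<le> e a}. e a \<le> u"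
  proof (rule filtered_le_open[OF assms(2)])
    show "Inf (e ` {a. k \<le> e a}) \<le> u"
      using assms(3) closed_eq[OF assms(1)] by simp
    show "{a. k \<le> e a} \<noteq> {}"
      using e_hom(7) by (metis (mono_tags) top_greatest empty_Collect_eq)
    show "\<exists>c\<in>{a. k \<le> e a}. e c \<le> e a \<and> e c \<le> e b"
      if "a \<in> {a. k \<le> e a}" "b \<in> {a. k \<le> e a}" for a b
      using that by (auto intro!: exI[of _ "inf a b"])
  qed
  then show ?thesis by auto
qed

section \<open>Clopen approximation of the connectives\<close>

lemma approximants_directed:
  assumes "signed_le s x (e a)" "signed_le s x (e b)"
  shows "\<exists>c. signed_le s x (e c) \<and> signed_le s (e c) (e a) \<and> signed_le s (e c) (e b)"
  using assms by (intro exI[of _ "if s then inf a b else sup a b"]) (cases s; simp)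

lemma approximants_nonempty: "\<exists>a. signed_le s x (e a)"
  by (intro exI[of _ "if s then top else bot"]) (cases s; simp)

text \<open>An inequality between a value at topological arguments and a bound of the opposite kind
  is already witnessed by clopen arguments. The element d between value and bound is part of the
  condition because a residual of clopen elements need not be clopen.\<close>

definition interpolates :: "bool \<Rightarrow> bool \<Rightarrow> bool \<Rightarrow> ('b \<Rightarrow> 'b \<Rightarrow> 'b) \<Rightarrow> bool"
  where "interpolates s s1 s2 g \<longleftrightarrow>
    (\<forall>x x' y y'. signed_le s1 x x' \<longrightarrow> signed_le s2 y y' \<longrightarrow> signed_le s (g x y) (g x' y')) \<and>
    (\<forall>x y z. topological s1 x \<longrightarrow> topological s2 y \<longrightarrow> topological (\<not> s) z \<longrightarrow>
      signed_le s (g x y) z \<longrightarrow> (\<exists>a b d. signed_le s1 x (e a) \<and> signed_le s2 y (e b) \<and>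
        signed_le s (g (e a) (e b)) (e d) \<and> signed_le s (e d) z))"

text \<open>The values at clopen approximants form a filtered family in the image of e, so
  compactness puts a single one below the open bound z; d is that value.\<close>

lemma interpolates_Inf:
  assumes mono: "\<And>x x' y y'. signed_le s1 x x' \<Longrightarrow> signed_le s2 y y' \<Longrightarrow> g x y \<le> g x' y'"
    and hom: "\<And>a b. e (G a b) = g (e a) (e b)"
    and below: "\<And>x y. topological s1 x \<Longrightarrow> topological s2 y \<Longrightarrow>
      Inf (e ` {G a b | a b. signed_le s1 x (e a) \<and> signed_le s2 y (e b)}) \<le> g x y"
  shows "interpolates True s1 s2 g"
  unfolding interpolates_def
proof (intro conjI allI impI)
  fix x y z
  assume *: "topological s1 x" "topological s2 y" "topological (\<not> True) z" "signed_le True (g x y) z"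
  let ?S = "{G a b | a b. signed_le s1 x (e a) \<and> signed_le s2 y (e b)}"
  have "\<exists>d\<in>?S. e d \<le> z"
  proof (rule filtered_le_open)
    show "Inf (e ` ?S) \<le> z"
      using below[OF *(1,2)] *(4) unfolding signed_le_simps by (rule order_trans)
    obtain a b where "signed_le s1 x (e a)" "signed_le s2 y (e b)"
      using approximants_nonempty[of s1 x] approximants_nonempty[of s2 y] by blast
    then have "G a b \<in> ?S"
      by blast
    then show "?S \<noteq> {}"
      by blast
  next
    fix c d assume "c \<in> ?S" "d \<in> ?S"
    then obtain a b a' b' where ab: "c = G a b" "d = G a' b'"
      "signed_le s1 x (e a)" "signed_le s1 x (e a')"
      "signed_le s2 y (e b)" "signed_le s2 y (e b')" by blast
    obtain a'' where a: "signed_le s1 x (e a'')" "signed_le s1 (e a'') (e a)"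
      "signed_le s1 (e a'') (e a')"
      using approximants_directed[OF ab(3,4)] by blast
    obtain b'' where b: "signed_le s2 y (e b'')" "signed_le s2 (e b'') (e b)"
      "signed_le s2 (e b'') (e b')"
      using approximants_directed[OF ab(5,6)] by blast
    have "G a'' b'' \<in> ?S"
      using a(1) b(1) by blast
    moreover have "e (G a'' b'') \<le> e c" "e (G a'' b'') \<le> e d"
      unfolding ab(1,2) hom by (rule mono[OF a(2) b(2)], rule mono[OF a(3) b(3)])
    ultimately show "\<exists>t\<in>?S. e t \<le> e c \<and> e t \<le> e d"
      by blast
  qed (use *(3) in simp)
  then obtain a b where "signed_le s1 x (e a)" "signed_le s2 y (e b)" "e (G a b) \<le> z"
    by blast
  then show "\<exists>a b d. signed_le s1 x (e a) \<and> signed_le s2 y (e b) \<and>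
        signed_le True (g (e a) (e b)) (e d) \<and> signed_le True (e d) z"
    unfolding hom[symmetric] by (intro exI[of _ a] exI[of _ b] exI[of _ "G a b"]) simp
qed (simp add: mono)

lemma interpolates_Sup:
  assumes mono: "\<And>x x' y y'. signed_le s1 x x' \<Longrightarrow> signed_le s2 y y' \<Longrightarrow> g x' y' \<le> g x y"
    and hom: "\<And>a b. e (G a b) = g (e a) (e b)"
    and above: "\<And>x y. topological s1 x \<Longrightarrow> topological s2 y \<Longrightarrow>
      g x y \<le> Sup (e ` {G a b | a b. signed_le s1 x (e a) \<and> signed_le s2 y (e b)})"
  shows "interpolates False s1 s2 g"
  unfolding interpolates_def
proof (intro conjI allI impI)
  fix x y z
  assume *: "topological s1 x" "topological s2 y" "topological (\<not> False) z" "signed_le False (g x y) z"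
  let ?S = "{G a b | a b. signed_le s1 x (e a) \<and> signed_le s2 y (e b)}"
  have "\<exists>d\<in>?S. z \<le> e d"
  proof (rule closed_le_directed)
    show "z \<le> Sup (e ` ?S)"
      using *(4) above[OF *(1,2)] unfolding signed_le_simps by (rule order_trans)
    obtain a b where "signed_le s1 x (e a)" "signed_le s2 y (e b)"
      using approximants_nonempty[of s1 x] approximants_nonempty[of s2 y] by blast
    then have "G a b \<in> ?S"
      by blast
    then show "?S \<noteq> {}"
      by blast
  next
    fix c d assume "c \<in> ?S" "d \<in> ?S"
    then obtain a b a' b' where ab: "c = G a b" "d = G a' b'"
      "signed_le s1 x (e a)" "signed_le s1 x (e a')"
      "signed_le s2 y (e b)" "signed_le s2 y (e b')" by blast
    obtain a'' where a: "signed_le s1 x (e a'')" "signed_le s1 (e a'') (e a)"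
      "signed_le s1 (e a'') (e a')"
      using approximants_directed[OF ab(3,4)] by blast
    obtain b'' where b: "signed_le s2 y (e b'')" "signed_le s2 (e b'') (e b)"
      "signed_le s2 (e b'') (e b')"
      using approximants_directed[OF ab(5,6)] by blast
    have "G a'' b'' \<in> ?S"
      using a(1) b(1) by blast
    moreover have "e c \<le> e (G a'' b'')" "e d \<le> e (G a'' b'')"
      unfolding ab(1,2) hom by (rule mono[OF a(2) b(2)], rule mono[OF a(3) b(3)])
    ultimately show "\<exists>t\<in>?S. e c \<le> e t \<and> e d \<le> e t"
      by blast
  qed (use *(3) in simp)
  then obtain a b where "signed_le s1 x (e a)" "signed_le s2 y (e b)" "z \<le> e (G a b)"
    by blast
  then show "\<exists>a b d. signed_le s1 x (e a) \<and> signed_le s2 y (e b) \<and>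
        signed_le False (g (e a) (e b)) (e d) \<and> signed_le False (e d) z"
    unfolding hom[symmetric] by (intro exI[of _ a] exI[of _ b] exI[of _ "G a b"]) simp
qed (simp add: mono)

lemma image2_le_Sup:
  "P a b \<Longrightarrow> e (G a b) \<le> Sup (e ` {G a b | a b. P a b})"
  by (rule SUP_upper) blast

lemma Inf_le_image2:
  "P a b \<Longrightarrow> Inf (e ` {G a b | a b. P a b}) \<le> e (G a b)"
  by (rule INF_lower) blast

lemma interpolates_fusion: "interpolates s s s fusion"
proof (cases s)
  case True
  have "interpolates True True True fusion"
  proof (rule interpolates_Inf)
    fix x y assume "topological True x" "topological True y"
    then have "Inf {e (fusion a b) | a b. x \<le> e a \<and> y \<le> e b} \<le> fusion_sigma e x y"
      \<comment> \<open>The closed elements x and y themselves are among the choices for k and l in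
        the sigma-extension.\<close>
      unfolding fusion_sigma_def topological_def by (intro Sup_upper) auto
    also have "\<dots> = fusion x y"
      using canonical by (simp add: canonical_extension_def)
    also have "{e (fusion a b) | a b. x \<le> e a \<and> y \<le> e b} =
      e ` {fusion a b | a b. signed_le True x (e a) \<and> signed_le True y (e b)}"
      unfolding signed_le_simps by blast
    finally show "Inf (e ` {fusion a b | a b. signed_le True x (e a) \<and> signed_le True y (e b)})
      \<le> fusion x y" .
  qed (simp_all add: fusion_mono)
  with True show ?thesis by simp
next
  case False
  have "interpolates False False False fusion"
  proof (rule interpolates_Sup)
    fix x y assume *: "topological False x" "topological False y"
    have "fusion x y = (SUP a\<in>{a. e a \<le> x}. SUP b\<in>{b. e b \<le> y}. fusion (e a) (e b))"
      by (subst open_eq[OF *(1)], subst open_eq[OF *(2)])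
        (simp add: fusion_Sup_left fusion_Sup_right image_image, rule SUP_commute)
    also have "\<dots> \<le> Sup (e ` {fusion a b | a b. signed_le False x (e a) \<and> signed_le False y (e b)})"
      unfolding e_hom(3)[symmetric] by (intro SUP_least image2_le_Sup) simp
    finally show "fusion x y \<le> Sup (e ` {fusion a b | a b.
      signed_le False x (e a) \<and> signed_le False y (e b)})" .
  qed (simp_all add: fusion_mono)
  with False show ?thesis by simp
qed

text \<open>Compared with fusion the roles are exchanged: the pi-extension serves the reading
  \<open>False\<close>, complete preservation the reading \<open>True\<close>.\<close>

lemma interpolates_rimp: "interpolates s (\<not> s) s rimp"
proof (cases s)
  case True
  have "interpolates True False True rimp"
  proof (rule interpolates_Inf)
    fix x y assume *: "topological False x" "topological True y"
    have "Inf (e ` {rimp a b | a b. signed_le False x (e a) \<and> signed_le True y (e b)})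
      \<le> (INF a\<in>{a. e a \<le> x}. INF b\<in>{b. y \<le> e b}. rimp (e a) (e b))"
      unfolding e_hom(4)[symmetric] by (intro INF_greatest Inf_le_image2) simp
    also have "\<dots> = rimp x y"
      by (subst (2) open_eq[OF *(1)], subst (2) closed_eq[OF *(2)])
        (simp add: rimp_Sup rimp_Inf image_image, rule INF_commute)
    finally show "Inf (e ` {rimp a b | a b. signed_le False x (e a) \<and> signed_le True y (e b)})
      \<le> rimp x y" .
  qed (simp_all add: rimp_mono)
  with True show ?thesis by simp
next
  case False
  have "interpolates False True False rimp"
  proof (rule interpolates_Sup)
    fix x y assume "topological True x" "topological False y"
    have "rimp x y = rimp_pi e x y"
      using canonical by (simp add: canonical_extension_def)
    also have "\<dots> \<le> Sup {e (rimp a b) | a b. x \<le> e a \<and> e b \<le> y}"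
      using \<open>topological True x\<close> \<open>topological False y\<close>
      unfolding rimp_pi_def topological_def by (intro Inf_lower) auto
    also have "{e (rimp a b) | a b. x \<le> e a \<and> e b \<le> y} =
      e ` {rimp a b | a b. signed_le True x (e a) \<and> signed_le False y (e b)}"
      unfolding signed_le_simps by blast
    finally show "rimp x y \<le> Sup (e ` {rimp a b | a b.
      signed_le True x (e a) \<and> signed_le False y (e b)})" .
  qed (simp_all add: rimp_mono)
  with False show ?thesis by simp
qed

text \<open>Both readings follow from the complete reversal of joins and meets. The second argument
  is a dummy that lets unary connectives share the binary notion.\<close>

lemma interpolates_rneg: "interpolates s (\<not> s) (\<not> s) (\<lambda>x y. rneg x)"
proof (cases s)
  case True
  have "interpolates True False False (\<lambda>x y. rneg x)"
  proof (rule interpolates_Inf)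
    fix x y assume *: "topological False x" "topological False y"
    have "Inf (e ` {rneg a | a b. signed_le False x (e a) \<and> signed_le False y (e b)})
      \<le> (INF a\<in>{a. e a \<le> x}. rneg (e a))"
      unfolding e_hom(5)[symmetric]
      using approximants_nonempty[of False y] by (intro INF_greatest INF_lower) auto
    also have "\<dots> = rneg x"
      by (subst (2) open_eq[OF *(1)]) (simp add: rneg_Sup image_image)
    finally show "Inf (e ` {rneg a | a b. signed_le False x (e a) \<and> signed_le False y (e b)})
      \<le> rneg x" .
  qed (simp_all add: rneg_antimono)
  with True show ?thesis by simp
next
  case False
  have "interpolates False True True (\<lambda>x y. rneg x)"
  proof (rule interpolates_Sup)
    fix x y assume *: "topological True x" "topological True y"
    have "rneg x = (SUP a\<in>{a. x \<le> e a}. rneg (e a))"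
      by (subst closed_eq[OF *(1)]) (simp add: rneg_Inf image_image)
    also have "\<dots> \<le> Sup (e ` {rneg a | a b. signed_le True x (e a) \<and> signed_le True y (e b)})"
      unfolding e_hom(5)[symmetric]
      using approximants_nonempty[of True y] by (intro SUP_least SUP_upper) auto
    finally show "rneg x \<le> Sup (e ` {rneg a | a b.
      signed_le True x (e a) \<and> signed_le True y (e b)})" .
  qed (simp_all add: rneg_antimono)
  with False show ?thesis by simp
qed

lemma interpolates_inf: "interpolates s s s inf"
proof (cases s)
  case True
  have "interpolates True True True inf"
  proof (rule interpolates_Inf)
    fix x y assume *: "topological True x" "topological True y"
    let ?S = "{inf a b | a b. signed_le True x (e a) \<and> signed_le True y (e b)}"
    have "Inf (e ` ?S) \<le> Inf (e ` {a. x \<le> e a})"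
    proof (rule INF_greatest)
      fix a assume "a \<in> {a. x \<le> e a}"
      \<comment> \<open>Padding with \<open>top\<close> gives an approximant of x the shape of a
        member of \<open>?S\<close>.\<close>
      then have "Inf (e ` ?S) \<le> e (inf a top)" by (intro Inf_le_image2) simp
      then show "Inf (e ` ?S) \<le> e a" by (simp only: inf_top_right)
    qed
    moreover have "Inf (e ` ?S) \<le> Inf (e ` {b. y \<le> e b})"
    proof (rule INF_greatest)
      fix b assume "b \<in> {b. y \<le> e b}"
      then have "Inf (e ` ?S) \<le> e (inf top b)" by (intro Inf_le_image2) simp
      then show "Inf (e ` ?S) \<le> e b" by (simp only: inf_top_left)
    qed
    ultimately show "Inf (e ` ?S) \<le> inf x y"
      unfolding closed_eq[OF *(1), symmetric] closed_eq[OF *(2), symmetric] by (rule inf_greatest)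
  qed (simp_all add: le_infI1 le_infI2)
  with True show ?thesis by simp
next
  case False
  have "\<exists>a b d. e a \<le> x \<and> e b \<le> y \<and> e d \<le> inf (e a) (e b) \<and> z \<le> e d"
    if *: "topological False x" "topological False y" "topological True z" "z \<le> inf x y" for x y z
  proof -
    obtain a b where "z \<le> e a" "e a \<le> x" "z \<le> e b" "e b \<le> y"
      using interpolate[OF *(3,1)] interpolate[OF *(3,2)] *(4) by auto
    then show ?thesis
      by (intro exI[of _ a] exI[of _ b] exI[of _ "inf a b"]) simp
  qed
  with False show ?thesis
    unfolding interpolates_def by (simp add: le_infI1 le_infI2)
qed

lemma interpolates_sup: "interpolates s s s sup"
proof (cases s)
  case True
  have "\<exists>a b d. x \<le> e a \<and> y \<le> e b \<and> sup (e a) (e b) \<le> e d \<and> e d \<le> z"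
    if *: "topological True x" "topological True y" "topological False z" "sup x y \<le> z" for x y z
  proof -
    obtain a b where "x \<le> e a" "e a \<le> z" "y \<le> e b" "e b \<le> z"
      using interpolate[OF *(1,3)] interpolate[OF *(2,3)] *(4) by auto
    then show ?thesis
      by (intro exI[of _ a] exI[of _ b] exI[of _ "sup a b"]) simp
  qed
  with True show ?thesis
    unfolding interpolates_def by (simp add: le_supI1 le_supI2)
next
  case False
  have "interpolates False False False sup"
  proof (rule interpolates_Sup)
    fix x y assume *: "topological False x" "topological False y"
    let ?S = "{sup a b | a b. signed_le False x (e a) \<and> signed_le False y (e b)}"
    have "Sup (e ` {a. e a \<le> x}) \<le> Sup (e ` ?S)"
    proof (rule SUP_least)
      fix a assume "a \<in> {a. e a \<le> x}"
      then have "e (sup a bot) \<le> Sup (e ` ?S)" by (intro image2_le_Sup) simp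
      then show "e a \<le> Sup (e ` ?S)" by (simp only: sup_bot_right)
    qed
    moreover have "Sup (e ` {b. e b \<le> y}) \<le> Sup (e ` ?S)"
    proof (rule SUP_least)
      fix b assume "b \<in> {b. e b \<le> y}"
      then have "e (sup bot b) \<le> Sup (e ` ?S)" by (intro image2_le_Sup) simp
      then show "e b \<le> Sup (e ` ?S)" by (simp only: sup_bot_left)
    qed
    ultimately show "sup x y \<le> Sup (e ` ?S)"
      unfolding open_eq[OF *(1), symmetric] open_eq[OF *(2), symmetric] by (rule sup_least)
  qed (simp_all add: le_supI1 le_supI2)
  with False show ?thesis by simp
qed

lemma interpolates_apply:
  assumes "interpolates s s1 s2 g" "topological s1 x" "topological s2 y" "topological (\<not> s) z"
    "signed_le s (g x y) z"
  shows "\<exists>a b d. signed_le s1 x (e a) \<and> signed_le s2 y (e b) \<and>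
    signed_le s (g (e a) (e b)) (e d) \<and> signed_le s (e d) z"
  using assms unfolding interpolates_def by blast

text \<open>The adjunction swaps argument and bound: \<open>neg_flat x \<le> z\<close> means
  \<open>rneg z \<le> x\<close>, and negation interpolates this at a clopen d, so
  \<open>rneg d\<close> serves as approximant of x. The later residuals are reduced to their adjoint
  connective in the same way.\<close>

lemma interpolates_neg_flat: "interpolates True False False (\<lambda>x y. neg_flat x)"
proof -
  have "\<exists>a b d. e a \<le> x \<and> e b \<le> y \<and> neg_flat (e a) \<le> e d \<and> e d \<le> z"
    if *: "topological False x" "topological False y" "topological False z" "neg_flat x \<le> z" for x y z
  proof -
    have "\<exists>d. e d \<le> z \<and> rneg (e d) \<le> x"
      using interpolates_apply[OF interpolates_rneg[of True], of z z x] *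
      by (simp add: neg_flat_adj) (meson order_trans)
    then obtain d where "e d \<le> z" "rneg (e d) \<le> x" by blast
    moreover obtain b where "e b \<le> y"
      using approximants_nonempty[of False] by auto
    ultimately show ?thesis
      by (intro exI[of _ "rneg d"] exI[of _ b] exI[of _ d]) (simp add: neg_flat_adj)
  qed
  then show ?thesis
    unfolding interpolates_def by (simp add: neg_flat_antimono)
qed

lemma interpolates_neg_sharp: "interpolates False True True (\<lambda>x y. neg_sharp x)"
proof -
  have "\<exists>a b d. x \<le> e a \<and> y \<le> e b \<and> e d \<le> neg_sharp (e a) \<and> z \<le> e d"
    if *: "topological True x" "topological True y" "topological True z" "z \<le> neg_sharp x" for x y z
  proof -
    have "\<exists>d. z \<le> e d \<and> x \<le> rneg (e d)"
      using interpolates_apply[OF interpolates_rneg[of False], of z z x] *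
      by (simp add: neg_sharp_adj) (meson order_trans)
    then obtain d where "z \<le> e d" "x \<le> rneg (e d)" by blast
    moreover obtain b where "y \<le> e b"
      using approximants_nonempty[of True] by auto
    ultimately show ?thesis
      by (intro exI[of _ "rneg d"] exI[of _ b] exI[of _ d]) (simp add: neg_sharp_adj)
  qed
  then show ?thesis
    unfolding interpolates_def by (simp add: neg_sharp_antimono)
qed

lemma interpolates_heyting: "interpolates False True False heyting"
proof -
  have "\<exists>a b d. x \<le> e a \<and> e b \<le> y \<and> e d \<le> heyting (e a) (e b) \<and> z \<le> e d"
    if *: "topological True x" "topological False y" "topological True z" "z \<le> heyting x y" for x y z
  proof -
    obtain d a c where "z \<le> e d" "x \<le> e a" "inf (e d) (e a) \<le> e c" "e c \<le> y"
      using interpolates_apply[OF interpolates_inf[of True], of z x y] *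
      by (auto simp: heyting_adj)
    then show ?thesis
      by (intro exI[of _ a] exI[of _ c] exI[of _ d]) (simp add: heyting_adj)
  qed
  then show ?thesis
    unfolding interpolates_def by (simp add: heyting_mono)
qed

lemma interpolates_coheyting: "interpolates True True False coheyting"
proof -
  have "\<exists>a b d. x \<le> e a \<and> e b \<le> y \<and> coheyting (e a) (e b) \<le> e d \<and> e d \<le> z"
    if *: "topological True x" "topological False y" "topological False z" "coheyting x y \<le> z" for x y z
  proof -
    obtain b d c where "e b \<le> y" "e d \<le> z" "e c \<le> sup (e b) (e d)" "x \<le> e c"
      using interpolates_apply[OF interpolates_sup[of False], of y z x] *
      by (auto simp: coheyting_adj)
    then show ?thesis
      by (intro exI[of _ c] exI[of _ b] exI[of _ d]) (simp add: coheyting_adj)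
  qed
  then show ?thesis
    unfolding interpolates_def by (simp add: coheyting_mono)
qed

lemma interpolates_tri_residual: "interpolates False True False tri_residual"
proof -
  have "\<exists>a b d. x \<le> e a \<and> e b \<le> y \<and> e d \<le> tri_residual (e a) (e b) \<and> z \<le> e d"
    if *: "topological True x" "topological False y" "topological True z" "z \<le> tri_residual x y" for x y z
  proof -
    obtain a d c where "x \<le> e a" "z \<le> e d" "fusion (e a) (e d) \<le> e c" "e c \<le> y"
      using interpolates_apply[OF interpolates_fusion[of True], of x z y] *
      by (auto simp: tri_residual_adj)
    then show ?thesis
      by (intro exI[of _ a] exI[of _ c] exI[of _ d]) (simp add: tri_residual_adj)
  qed
  then show ?thesis
    unfolding interpolates_def by (simp add: tri_residual_mono)
qed

end


section \<open>The topological Ackermann lemma\<close>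

locale ackermann = canonical e
  for e :: "'a::relevant_algebra \<Rightarrow> 'b::perfect_relevant_algebra" +
  fixes w :: "atom \<Rightarrow> 'b" and p :: nat and \<sigma> :: bool and z :: 'b
  assumes proper_w: "proper w"
    and w_clopen: "w (PVar q) \<in> range e"
    and z_topological: "topological \<sigma> z"
begin

text \<open>The values of p for which admissible validity gives information; they tend to z, from
  above or below according to \<sigma>.\<close>

definition nbhd :: "'b set"
  where "nbhd = {x \<in> range e. signed_le \<sigma> z x}"

lemma nbhd_nonempty: "\<exists>x. x \<in> nbhd"
  using approximants_nonempty unfolding nbhd_def by blast

lemma nbhd_directed:
  assumes "x \<in> nbhd" "y \<in> nbhd"
  shows "\<exists>t\<in>nbhd. signed_le \<sigma> t x \<and> signed_le \<sigma> t y"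
  using assms approximants_directed unfolding nbhd_def by blast

lemma nbhd_le: "x \<in> nbhd \<Longrightarrow> signed_le \<sigma> z x"
  by (simp add: nbhd_def)

definition signed_mono :: "bool \<Rightarrow> ('b \<Rightarrow> 'b) \<Rightarrow> bool"
  where "signed_mono s f \<longleftrightarrow> (\<forall>x y. signed_le \<sigma> x y \<longrightarrow> signed_le s (f x) (f y))"

text \<open>Values near z can be separated from any bound of the opposite kind by a clopen element.
  This makes the limit value itself topological and is stable under all interpolating
  connectives.\<close>

definition approximable :: "bool \<Rightarrow> ('b \<Rightarrow> 'b) \<Rightarrow> bool"
  where "approximable s f \<longleftrightarrow> signed_mono s f \<and>
    (\<forall>u. topological (\<not> s) u \<longrightarrow> signed_le s (f z) u \<longrightarrow>
      (\<exists>x\<in>nbhd. \<exists>a. signed_le s (f x) (e a) \<and> signed_le s (e a) u))"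

text \<open>Weaker than \<open>approximable\<close>: only irreducible bounds are tested, and no
  clopen element is asked for in between, so the limit value need not be closed or open.\<close>

definition continuous :: "bool \<Rightarrow> ('b \<Rightarrow> 'b) \<Rightarrow> bool"
  where "continuous s f \<longleftrightarrow> signed_mono s f \<and>
    (\<forall>m. (if s then completely_meet_irreducible m else completely_join_irreducible m) \<longrightarrow>
      signed_le s (f z) m \<longrightarrow> (\<exists>x\<in>nbhd. signed_le s (f x) m))"

lemma signed_monoD: "signed_mono s f \<Longrightarrow> signed_le \<sigma> x y \<Longrightarrow> signed_le s (f x) (f y)"
  by (simp add: signed_mono_def)

lemma interpolate_signed:
  assumes "topological s x" "topological (\<not> s) y" "signed_le s x y"
  shows "\<exists>a. signed_le s x (e a) \<and> signed_le s (e a) y"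
  using assms interpolate[of x y] interpolate[of y x] by (cases s) auto

lemma approximable_const: "topological s c \<Longrightarrow> approximable s (\<lambda>_. c)"
  unfolding approximable_def signed_mono_def
  using nbhd_nonempty interpolate_signed by auto

lemma approximable_id: "approximable \<sigma> (\<lambda>x. x)"
  unfolding approximable_def signed_mono_def
proof (intro conjI allI impI)
  fix u assume "topological (\<not> \<sigma>) u" "signed_le \<sigma> z u"
  then obtain a where a: "signed_le \<sigma> z (e a)" "signed_le \<sigma> (e a) u"
    using interpolate_signed z_topological by blast
  then have "e a \<in> nbhd"
    by (simp add: nbhd_def)
  with a(2) show "\<exists>x\<in>nbhd. \<exists>a. signed_le \<sigma> x (e a) \<and> signed_le \<sigma> (e a) u"
    using signed_le_refl by blast
qed simp

text \<open>By density it suffices to compare \<open>f z\<close> with bounds of the opposite kind,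
  and each such bound is separated from it by a clopen element; so \<open>f z\<close> is the meet,
  or join, of clopen elements.\<close>

lemma approximable_topological:
  assumes "approximable s f"
  shows "topological s (f z)"
proof -
  have *: "\<exists>a. signed_le s (f z) (e a) \<and> signed_le s (e a) u"
    if "topological (\<not> s) u" "signed_le s (f z) u" for u
    using assms that nbhd_le signed_le_trans signed_monoD unfolding approximable_def by meson
  show ?thesis
  proof (cases s)
    case True
    have "Inf (e ` {a. f z \<le> e a}) \<le> f z"
    proof (rule le_via_open)
      fix u assume "topological False u" "f z \<le> u"
      then obtain a where "f z \<le> e a" "e a \<le> u"
        using *[of u] True by auto
      then show "Inf (e ` {a. f z \<le> e a}) \<le> u"
        by (auto intro: INF_lower2)
    qed
    then have "f z = Inf (e ` {a. f z \<le> e a})"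
      by (auto intro!: antisym INF_greatest)
    with True show ?thesis
      unfolding topological_def closed_element_def by auto
  next
    case False
    have "f z \<le> Sup (e ` {a. e a \<le> f z})"
    proof (rule le_via_closed)
      fix u assume "topological True u" "u \<le> f z"
      then obtain a where "e a \<le> f z" "u \<le> e a"
        using *[of u] False by auto
      then show "u \<le> Sup (e ` {a. e a \<le> f z})"
        by (auto intro: SUP_upper2)
    qed
    then have "f z = Sup (e ` {a. e a \<le> f z})"
      by (auto intro!: antisym SUP_least)
    with False show ?thesis
      unfolding topological_def open_element_def by auto
  qed
qed

lemma approximable_near:
  assumes "approximable s f" "signed_le s (f z) (e a)"
  shows "\<exists>x\<in>nbhd. signed_le s (f x) (e a)"
  using assms signed_le_trans topological_e unfolding approximable_def by meson

text \<open>Interpolating at z yields clopen bounds for both arguments. Each is reached somewhere in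
  \<open>nbhd\<close>, and directedness supplies a common point.\<close>

lemma approximable_combine:
  assumes g: "interpolates s s1 s2 g" and f: "approximable s1 f" and h: "approximable s2 h"
  shows "approximable s (\<lambda>x. g (f x) (h x))"
proof -
  have g_mono: "signed_le s (g x y) (g x' y')"
    if "signed_le s1 x x'" "signed_le s2 y y'" for x x' y y'
    using g that unfolding interpolates_def by blast
  have mono: "signed_mono s1 f" "signed_mono s2 h"
    using f h by (simp_all add: approximable_def)
  have "\<exists>x\<in>nbhd. \<exists>a. signed_le s (g (f x) (h x)) (e a) \<and> signed_le s (e a) u"
    if u: "topological (\<not> s) u" "signed_le s (g (f z) (h z)) u" for u
  proof -
    obtain a b d where abd: "signed_le s1 (f z) (e a)" "signed_le s2 (h z) (e b)"
      "signed_le s (g (e a) (e b)) (e d)" "signed_le s (e d) u"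
      using interpolates_apply[OF g approximable_topological[OF f] approximable_topological[OF h] u]
      by blast
    obtain x where x: "x \<in> nbhd" "signed_le s1 (f x) (e a)"
      using approximable_near[OF f abd(1)] by blast
    obtain y where y: "y \<in> nbhd" "signed_le s2 (h y) (e b)"
      using approximable_near[OF h abd(2)] by blast
    obtain t where t: "t \<in> nbhd" "signed_le \<sigma> t x" "signed_le \<sigma> t y"
      using nbhd_directed x(1) y(1) by blast
    have "signed_le s1 (f t) (e a)" "signed_le s2 (h t) (e b)"
      using mono t x y signed_monoD signed_le_trans by blast+
    then have "signed_le s (g (f t) (h t)) (e d)"
      using g_mono abd(3) signed_le_trans by blast
    with t(1) abd(4) show ?thesis
      by blast
  qed
  then show ?thesis
    using mono g_mono unfolding approximable_def signed_mono_def by blast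
qed

lemma approximable_unary:
  "interpolates s s1 s1 (\<lambda>x y. g x) \<Longrightarrow> approximable s1 f \<Longrightarrow> approximable s (\<lambda>x. g (f x))"
  by (rule approximable_combine)

lemma approximable_val:
  assumes "level s A \<le> 3" "signed (s = \<sigma>) p A"
  shows "approximable s (\<lambda>x. val (w(PVar p := x)) A)"
  using assms
proof (induction A arbitrary: s)
  case (At x)
  show ?case
  proof (cases x)
    case (PVar q)
    show ?thesis
    proof (cases "q = p")
      case True
      then show ?thesis
        using At PVar approximable_id by auto
    next
      case False
      obtain a where "w (PVar q) = e a"
        using w_clopen by blast
      then show ?thesis
        using PVar False by (simp add: approximable_const)
    qed
  next
    case (Nom j)
    then show ?thesis
      using At proper_w by (cases s) (auto simp: proper_def intro: approximable_const cji_closed)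
  next
    case (CoNom m)
    then show ?thesis
      using At proper_w by (cases s) (auto simp: proper_def intro: approximable_const cmi_open)
  qed
next
  case Bot
  then show ?case using approximable_const[OF topological_e[of s bot]] by simp
next
  case Top
  then show ?case using approximable_const[OF topological_e[of s top]] by simp
next
  case Unit
  then show ?case using approximable_const[OF topological_e[of s runit]] by simp
next
  case (Neg A)
  then show ?case
    using approximable_unary[OF interpolates_rneg[of s]] by (cases s) auto
next
  case (And A B)
  then show ?case
    using approximable_combine[OF interpolates_inf[of s]] by (cases s) auto
next
  case (Or A B)
  then show ?case
    using approximable_combine[OF interpolates_sup[of s]] by (cases s) auto
next
  case (Fus A B)
  then show ?case
    using approximable_combine[OF interpolates_fusion[of s]] by (cases s) auto
next
  case (Imp A B)
  then show ?case
    using approximable_combine[OF interpolates_rimp[of s]] by (cases s) auto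
next
  case (NegFlat A)
  then show ?case
    using approximable_unary[OF interpolates_neg_flat] by (cases s) auto
next
  case (NegSharp A)
  then show ?case
    using approximable_unary[OF interpolates_neg_sharp] by (cases s) auto
next
  case (HImp A B)
  then show ?case
    using approximable_combine[OF interpolates_heyting] by (cases s) auto
next
  case (CoImp A B)
  then show ?case
    using approximable_combine[OF interpolates_coheyting] by (cases s) auto
next
  case (Tri A B)
  then show ?case
    using approximable_combine[OF interpolates_tri_residual] by (cases s) auto
qed

section \<open>Continuity against irreducible bounds\<close>

lemma continuousI:
  assumes "signed_mono s f"
    and "\<And>m. s \<Longrightarrow> completely_meet_irreducible m \<Longrightarrow> f z \<le> m \<Longrightarrow> \<exists>x\<in>nbhd. f x \<le> m"
    and "\<And>j. \<not> s \<Longrightarrow> completely_join_irreducible j \<Longrightarrow> j \<le> f z \<Longrightarrow> \<exists>x\<in>nbhd. j \<le> f x"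
  shows "continuous s f"
  using assms unfolding continuous_def by (cases s) auto

lemma continuous_leD:
  "continuous True f \<Longrightarrow> completely_meet_irreducible m \<Longrightarrow> f z \<le> m \<Longrightarrow> \<exists>x\<in>nbhd. f x \<le> m"
  by (simp add: continuous_def)

lemma continuous_geD:
  "continuous False f \<Longrightarrow> completely_join_irreducible j \<Longrightarrow> j \<le> f z \<Longrightarrow> \<exists>x\<in>nbhd. j \<le> f x"
  by (simp add: continuous_def)

lemma continuous_mono: "continuous s f \<Longrightarrow> signed_mono s f"
  by (simp add: continuous_def)

lemma approximable_continuous:
  assumes "approximable s f"
  shows "continuous s f"
proof (rule continuousI)
  show "signed_mono s f"
    using assms by (simp add: approximable_def)
  show "\<exists>x\<in>nbhd. f x \<le> m" if s "completely_meet_irreducible m" "f z \<le> m" for m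
    using that assms cmi_open unfolding approximable_def by simp (meson order_trans)
  show "\<exists>x\<in>nbhd. j \<le> f x" if "\<not> s" "completely_join_irreducible j" "j \<le> f z" for j
    using that assms cji_closed unfolding approximable_def by simp (meson order_trans)
qed

text \<open>The constant is arbitrary; this is what admits co-nominals on the left and nominals on
  the right, at level 4.\<close>

lemma continuous_const: "continuous s (\<lambda>_. c)"
  using nbhd_nonempty by (auto simp: continuous_def signed_mono_def)

lemma nbhd_common:
  assumes "signed_mono s1 f" "signed_mono s2 h"
    and "\<exists>x\<in>nbhd. signed_le s1 (f x) a" "\<exists>x\<in>nbhd. signed_le s2 (h x) b"
  shows "\<exists>x\<in>nbhd. signed_le s1 (f x) a \<and> signed_le s2 (h x) b"
proof -
  obtain x y where xy: "x \<in> nbhd" "y \<in> nbhd" "signed_le s1 (f x) a" "signed_le s2 (h y) b"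
    using assms(3,4) by blast
  obtain t where t: "t \<in> nbhd" "signed_le \<sigma> t x" "signed_le \<sigma> t y"
    using nbhd_directed xy(1,2) by blast
  have "signed_le s1 (f t) a" "signed_le s2 (h t) b"
    using assms(1,2) t xy signed_monoD signed_le_trans by blast+
  with t(1) show ?thesis by blast
qed

lemma continuous_sup:
  assumes "continuous True f" "continuous True h"
  shows "continuous True (\<lambda>x. sup (f x) (h x))"
proof (rule continuousI)
  show "signed_mono True (\<lambda>x. sup (f x) (h x))"
    using assms by (simp add: continuous_def signed_mono_def le_supI1 le_supI2)
  fix m assume "completely_meet_irreducible m" "sup (f z) (h z) \<le> m"
  then show "\<exists>x\<in>nbhd. sup (f x) (h x) \<le> m"
    using nbhd_common[of True f True h m m] assms by (simp add: continuous_def)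
qed simp

lemma continuous_inf:
  assumes "continuous False f" "continuous False h"
  shows "continuous False (\<lambda>x. inf (f x) (h x))"
proof (rule continuousI)
  show "signed_mono False (\<lambda>x. inf (f x) (h x))"
    using assms by (simp add: continuous_def signed_mono_def le_infI1 le_infI2)
  fix j assume "completely_join_irreducible j" "j \<le> inf (f z) (h z)"
  then show "\<exists>x\<in>nbhd. j \<le> inf (f x) (h x)"
    using nbhd_common[of False f False h j j] assms by (simp add: continuous_def)
qed simp

text \<open>Primeness of i reduces the arguments of the fusion to one join-irreducible each, and f
  and h reach these at a common point of \<open>nbhd\<close>.\<close>

lemma continuous_fusion:
  assumes "continuous False f" "continuous False h"
  shows "continuous False (\<lambda>x. fusion (f x) (h x))"
proof (rule continuousI)
  show "signed_mono False (\<lambda>x. fusion (f x) (h x))"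
    using assms by (simp add: continuous_def signed_mono_def fusion_mono)
  fix i assume i: "completely_join_irreducible i" "i \<le> fusion (f z) (h z)"
  obtain j where j: "completely_join_irreducible j" "j \<le> f z" "i \<le> fusion j (h z)"
    using cji_le_fusion(1)[OF i] by blast
  obtain k where k: "completely_join_irreducible k" "k \<le> h z" "i \<le> fusion j k"
    using cji_le_fusion(2)[OF i(1) j(3)] by blast
  obtain x where "x \<in> nbhd" "j \<le> f x" "k \<le> h x"
    using nbhd_common[of False f False h j k] assms j k by (auto simp: continuous_def)
  then show "\<exists>x\<in>nbhd. i \<le> fusion (f x) (h x)"
    using k(3) fusion_mono order_trans by blast
qed simp

lemma continuous_rimp:
  assumes "continuous False f" "continuous True h"
  shows "continuous True (\<lambda>x. rimp (f x) (h x))"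
proof (rule continuousI)
  show "signed_mono True (\<lambda>x. rimp (f x) (h x))"
    using assms by (simp add: continuous_def signed_mono_def rimp_mono)
  fix m assume m: "completely_meet_irreducible m" "rimp (f z) (h z) \<le> m"
  obtain j where j: "completely_join_irreducible j" "j \<le> f z" "rimp j (h z) \<le> m"
    using rimp_le_cmi(1)[OF m] by blast
  obtain n where n: "completely_meet_irreducible n" "h z \<le> n" "rimp j n \<le> m"
    using rimp_le_cmi(2)[OF m(1) j(3)] by blast
  obtain x where "x \<in> nbhd" "j \<le> f x" "h x \<le> n"
    using nbhd_common[of False f True h j n] assms j n by (auto simp: continuous_def)
  then show "\<exists>x\<in>nbhd. rimp (f x) (h x) \<le> m"
    using n(3) rimp_mono order_trans by blast
qed simp

lemma continuous_rneg:
  assumes "continuous (\<not> s) f"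
  shows "continuous s (\<lambda>x. rneg (f x))"
proof (rule continuousI)
  show "signed_mono s (\<lambda>x. rneg (f x))"
    using assms by (cases s) (simp_all add: continuous_def signed_mono_def rneg_antimono)
next
  fix m assume s: s and m: "completely_meet_irreducible m" "rneg (f z) \<le> m"
  obtain j where j: "completely_join_irreducible j" "j \<le> f z" "rneg j \<le> m"
    using rneg_le_cmi[OF m] by blast
  obtain x where "x \<in> nbhd" "j \<le> f x"
    using continuous_geD[of f, OF _ j(1,2)] assms s by auto
  then show "\<exists>x\<in>nbhd. rneg (f x) \<le> m"
    using j(3) rneg_antimono order_trans by blast
next
  fix i assume s: "\<not> s" and i: "completely_join_irreducible i" "i \<le> rneg (f z)"
  obtain n where n: "completely_meet_irreducible n" "f z \<le> n" "i \<le> rneg n"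
    using cji_le_rneg[OF i] by blast
  obtain x where "x \<in> nbhd" "f x \<le> n"
    using continuous_leD[of f, OF _ n(1,2)] assms s by auto
  then show "\<exists>x\<in>nbhd. i \<le> rneg (f x)"
    using n(3) rneg_antimono order_trans by blast
qed

lemma closed_cap_le_5 [simp]: "closed_cap a b \<le> 5 \<longleftrightarrow> closed_cap a b \<le> 3"
  by (simp add: closed_cap_def)

lemma residual_cap_le_5 [simp]: "residual_cap a \<le> 5 \<longleftrightarrow> residual_cap a \<le> 3"
  by (simp add: residual_cap_def)

lemma continuous_cap_le_5: "continuous_cap a b \<le> 5 \<Longrightarrow> a \<le> 5 \<and> b \<le> 5"
  by (simp add: continuous_cap_def split: if_splits)

lemma continuous_val_low:
  "level s A \<le> 3 \<Longrightarrow> signed (s = \<sigma>) p A \<Longrightarrow> continuous s (\<lambda>x. val (w(PVar p := x)) A)"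
  by (rule approximable_continuous, rule approximable_val)

text \<open>A value of \<open>closed_cap\<close> or \<open>residual_cap\<close> that is at most 5 is
  at most 3, so such connectives fall under the approximable case; the others have their own
  continuity lemmas.\<close>

lemma continuous_val:
  "level s A \<le> 5 \<Longrightarrow> signed (s = \<sigma>) p A \<Longrightarrow> continuous s (\<lambda>x. val (w(PVar p := x)) A)"
proof (induction A arbitrary: s)
  case (At x)
  show ?case
  proof (cases "x = PVar p")
    case True
    with At.prems continuous_val_low[of s "At x"] show ?thesis by simp
  next
    case False
    then show ?thesis by (simp add: continuous_const)
  qed
next
  case (Neg A)
  have "level (\<not> s) A \<le> 5" "signed ((\<not> s) = \<sigma>) p A"
    using Neg.prems continuous_cap_le_5[of "level (\<not> s) A" "level (\<not> s) A"]
    by (cases s; simp)+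
  from Neg.IH[OF this] show ?case
    by (simp add: continuous_rneg)
next
  case (And A B)
  show ?case
  proof (cases s)
    case True
    with And.prems continuous_val_low[of s "And A B"] show ?thesis by (simp add: fun_upd_def)
  next
    case False
    with And.prems
    have "continuous False (\<lambda>x. val (w(PVar p := x)) A)"
        "continuous False (\<lambda>x. val (w(PVar p := x)) B)"
      by (auto intro!: And.IH)
    from continuous_inf[OF this] False show ?thesis by (simp add: fun_upd_def)
  qed
next
  case (Or A B)
  show ?case
  proof (cases s)
    case False
    with Or.prems continuous_val_low[of s "Or A B"] show ?thesis by (simp add: fun_upd_def)
  next
    case True
    with Or.prems
    have "continuous True (\<lambda>x. val (w(PVar p := x)) A)"
        "continuous True (\<lambda>x. val (w(PVar p := x)) B)"
      by (auto intro!: Or.IH)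
    from continuous_sup[OF this] True show ?thesis by (simp add: fun_upd_def)
  qed
next
  case (Fus A B)
  show ?case
  proof (cases s)
    case True
    with Fus.prems continuous_val_low[of s "Fus A B"] show ?thesis by (simp add: fun_upd_def)
  next
    case False
    with Fus.prems continuous_cap_le_5[of "level False A" "level False B"]
    have "continuous False (\<lambda>x. val (w(PVar p := x)) A)" "continuous False (\<lambda>x. val (w(PVar p := x)) B)"
      by (auto intro!: Fus.IH)
    from continuous_fusion[OF this] False show ?thesis by (simp add: fun_upd_def)
  qed
next
  case (Imp A B)
  show ?case
  proof (cases s)
    case False
    with Imp.prems continuous_val_low[of s "Imp A B"] show ?thesis by (simp add: fun_upd_def)
  next
    case True
    with Imp.prems continuous_cap_le_5[of "level False A" "level True B"]
    have "continuous False (\<lambda>x. val (w(PVar p := x)) A)" "continuous True (\<lambda>x. val (w(PVar p := x)) B)"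
      by (auto intro!: Imp.IH)
    from continuous_rimp[OF this] True show ?thesis by (simp add: fun_upd_def)
  qed
next
  case (NegFlat A)
  then show ?case
    using continuous_val_low[of s "NegFlat A"] by (cases s) (auto simp: fun_upd_def)
next
  case (NegSharp A)
  then show ?case
    using continuous_val_low[of s "NegSharp A"] by (cases s) (auto simp: fun_upd_def)
next
  case (HImp A B)
  then show ?case
    using continuous_val_low[of s "HImp A B"] by (cases s) (auto simp: fun_upd_def)
next
  case (CoImp A B)
  then show ?case
    using continuous_val_low[of s "CoImp A B"] by (cases s) (auto simp: fun_upd_def)
next
  case (Tri A B)
  then show ?case
    using continuous_val_low[of s "Tri A B"] by (cases s) (auto simp: fun_upd_def)
qed (simp_all add: continuous_const)

section \<open>Prime formulas and the limit of a quasi-inequality\<close>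

lemma closed_cap_gt_2 [simp]: "\<not> closed_cap a b \<le> 2"
  by (simp add: closed_cap_def)

lemma continuous_cap_gt_2 [simp]: "\<not> continuous_cap a b \<le> 2"
  by (simp add: continuous_cap_def)

lemma residual_cap_le_2 [simp]: "residual_cap a \<le> 2 \<longleftrightarrow> a \<le> 1"
  by (simp add: residual_cap_def)

text \<open>Such formulas are built from nominals or co-nominals by finite joins or meets and
  residual negation. Primeness lets their values feel a continuous limit already near z.\<close>

lemma small_val:
  assumes "level s A \<le> 2"
  shows "val (w(PVar p := y)) A = val w A"
    and "continuous (\<not> s) f \<Longrightarrow> signed_le s (val w A) (f z) \<Longrightarrow>
      \<exists>x\<in>nbhd. signed_le s (val w A) (f x)"
  using assms
proof (induction A arbitrary: s f)
  case (At x)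
  {
    case 1
    then show ?case by (cases x) auto
  next
    case 2
    then show ?case
      using proper_w continuous_leD[of f] continuous_geD[of f]
      by (cases x; cases s) (auto simp: proper_def)
  }
next
  case (And A B)
  {
    case 1
    then show ?case using And.IH(1,3)[of s] by (cases s) auto
  next
    case 2
    then show ?case
      using And.IH(2,4)[of False f] nbhd_common[of True f True f "val w A" "val w B"]
      by (cases s) (auto simp: continuous_def)
  }
next
  case (Or A B)
  {
    case 1
    then show ?case using Or.IH(1,3)[of s] by (cases s) auto
  next
    case 2
    then show ?case
      using Or.IH(2,4)[of True f] nbhd_common[of False f False f "val w A" "val w B"]
      by (cases s) (auto simp: continuous_def)
  }
next
  case (NegFlat A)
  {
    case 1
    then show ?case using NegFlat.IH(1)[of False] by (cases s) auto
  next
    case 2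
    then show ?case
      \<comment> \<open>\<open>neg_flat a \<le> f z\<close> means \<open>rneg (f z) \<le> a\<close>,
        so the hypothesis for the opposite reading applies to the continuous function
        \<open>rneg\<close> after f.\<close>
      using NegFlat.IH(2)[of False "\<lambda>x. rneg (f x)"] continuous_rneg[of True f]
      by (cases s) (auto simp: neg_flat_adj)
  }
next
  case (NegSharp A)
  {
    case 1
    then show ?case using NegSharp.IH(1)[of True] by (cases s) auto
  next
    case 2
    then show ?case
      using NegSharp.IH(2)[of True "\<lambda>x. rneg (f x)"] continuous_rneg[of False f]
      by (cases s) (auto simp: neg_sharp_adj)
  }
qed (auto split: if_splits)

lemma sat_mono:
  assumes "ineq_signed (\<not> \<sigma>) p i" "signed_le \<sigma> t x" "sat (w(PVar p := x)) i"
  shows "sat (w(PVar p := t)) i"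
  using assms sat_negative[of p i t x w] sat_positive[of p i x t w] by (cases \<sigma>) auto

text \<open>Either a clopen element separates a closed left side from an open right side, and each
  side reaches it independently, or one side is constant and prime and the other only has to be
  continuous.\<close>

lemma premise_near:
  assumes "admissible_premise i" "ineq_signed (\<not> \<sigma>) p i" "sat (w(PVar p := z)) i"
  shows "\<exists>x\<in>nbhd. sat (w(PVar p := x)) i"
proof (cases i)
  case (Leq A B)
  let ?A = "\<lambda>x. val (w(PVar p := x)) A" and ?B = "\<lambda>x. val (w(PVar p := x)) B"
  have signs: "signed (True = \<sigma>) p A" "signed (False = \<sigma>) p B"
    using assms(2) Leq by simp_all
  have levels: "level True A + level False B \<le> 6" and le: "?A z \<le> ?B z"
    using assms(1,3) Leq by simp_all
  consider "level True A \<le> 3" "level False B \<le> 3" | "level True A \<le> 2" "level False B \<le> 5"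
    | "level False B \<le> 2" "level True A \<le> 5"
    using levels level_pos[of True A] level_pos[of False B] by linarith
  then show ?thesis
  proof cases
    case 1
    then have A: "approximable True ?A" and B: "approximable False ?B"
      using approximable_val signs by blast+
    obtain a where a: "?A z \<le> e a" "e a \<le> ?B z"
      using interpolate[OF approximable_topological[OF A] approximable_topological[OF B] le] by blast
    have "\<exists>x\<in>nbhd. ?A x \<le> e a" "\<exists>x\<in>nbhd. e a \<le> ?B x"
      using approximable_near[OF A, of a] approximable_near[OF B, of a] a by auto
    then obtain x where "x \<in> nbhd" "?A x \<le> e a" "e a \<le> ?B x"
      using nbhd_common[of True ?A False ?B "e a" "e a"] A B by (auto simp: approximable_def)
    then show ?thesis
      using Leq by (auto intro: order_trans)
  next
    case 2
    then show ?thesis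
      using small_val[of True A] continuous_val[of False B] signs le Leq by auto
  next
    case 3
    then show ?thesis
      using small_val[of False B] continuous_val[of True A] signs le Leq by auto
  qed
qed

lemma premises_near:
  assumes "finite I" "\<forall>i\<in>I. admissible_premise i \<and> ineq_signed (\<not> \<sigma>) p i \<and> sat (w(PVar p := z)) i"
  shows "\<exists>x\<in>nbhd. \<forall>i\<in>I. sat (w(PVar p := x)) i"
  using assms
proof induction
  case empty
  then show ?case using nbhd_nonempty by auto
next
  case (insert i I)
  then obtain x where x: "x \<in> nbhd" "\<forall>i\<in>I. sat (w(PVar p := x)) i" by blast
  obtain y where y: "y \<in> nbhd" "sat (w(PVar p := y)) i"
    using premise_near[of i] insert.prems by (auto simp: fun_upd_def)
  obtain t where t: "t \<in> nbhd" "signed_le \<sigma> t x" "signed_le \<sigma> t y"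
    using nbhd_directed x(1) y(1) by blast
  have "\<forall>k\<in>insert i I. sat (w(PVar p := t)) k"
    using sat_mono[OF _ t(2)] sat_mono[OF _ t(3)] x y insert.prems by auto
  with t(1) show ?case by blast
qed

text \<open>Premises that hold at z hold at some x near z. Irreducibles j below the left and m above
  the right side of the consequent at z are reached near z as well; at a common point t the
  quasi-inequality applies and gives \<open>j \<le> m\<close>.\<close>

lemma qsat_limit:
  assumes admissible: "admissible_quasi (\<Gamma> \<tturnstile> c)"
    and signs: "ineq_signed \<sigma> p c" "\<forall>i\<in>fset \<Gamma>. ineq_signed (\<not> \<sigma>) p i"
    and near: "\<And>x. x \<in> nbhd \<Longrightarrow> qsat (w(PVar p := x)) (\<Gamma> \<tturnstile> c)"
  shows "qsat (w(PVar p := z)) (\<Gamma> \<tturnstile> c)"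
  unfolding qsat.simps
proof
  assume \<Gamma>: "\<forall>i\<in>fset \<Gamma>. sat (w(PVar p := z)) i"
  obtain L R where c: "c = (L \<preceq> R)"
    by (cases c)
  let ?L = "\<lambda>x. val (w(PVar p := x)) L" and ?R = "\<lambda>x. val (w(PVar p := x)) R"
  have L: "continuous False ?L" and R: "continuous True ?R"
    using admissible signs(1) c by (auto intro!: continuous_val)
  obtain x where x: "x \<in> nbhd" "\<forall>i\<in>fset \<Gamma>. sat (w(PVar p := x)) i"
    using premises_near[of "fset \<Gamma>"] admissible signs(2) \<Gamma> by auto
  have "?L z \<le> ?R z"
  proof (rule le_via_cji_cmi)
    fix j m
    assume jm: "completely_join_irreducible j" "completely_meet_irreducible m" "j \<le> ?L z" "?R z \<le> m"
    obtain y where y: "y \<in> nbhd" "j \<le> ?L y" "?R y \<le> m"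
      using nbhd_common[OF continuous_mono[OF L] continuous_mono[OF R], of j m]
        continuous_geD[OF L jm(1,3)] continuous_leD[OF R jm(2,4)] by auto
    obtain t where t: "t \<in> nbhd" "signed_le \<sigma> t x" "signed_le \<sigma> t y"
      using nbhd_directed x(1) y(1) by blast
    have "\<forall>i\<in>fset \<Gamma>. sat (w(PVar p := t)) i"
      using sat_mono[OF _ t(2)] x(2) signs(2) by auto
    then have "?L t \<le> ?R t"
      using near[OF t(1)] c by simp
    moreover have "j \<le> ?L t" "?R t \<le> m"
      using y signed_monoD[OF continuous_mono[OF L] t(3)] signed_monoD[OF continuous_mono[OF R] t(3)]
      by (auto intro: order_trans)
    ultimately show "j \<le> m"
      by (meson order_trans)
  qed
  then show "sat (w(PVar p := z)) c"
    by (simp add: c)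
qed

end


section \<open>Preservation of admissible validity\<close>

lemma signed_fresh: "PVar p \<notin> atoms A \<Longrightarrow> signed s p A"
  by (induction A arbitrary: s) auto

context canonical
begin

definition clopen :: "(atom \<Rightarrow> 'b) \<Rightarrow> bool"
  where "clopen w \<longleftrightarrow> proper w \<and> (\<forall>q. w (PVar q) \<in> range e)"

lemma clopen_upd: "clopen w \<Longrightarrow> x \<in> range e \<Longrightarrow> clopen (w(PVar p := x))"
  by (simp add: clopen_def proper_upd_var)

lemma valuation_class_clopen: "valuation_class clopen"
proof -
  have "clopen (w(x := y))" if "clopen w" "pure_value x y" for w x y
    using that by (cases x) (auto simp: clopen_def proper_def)
  then show ?thesis
    unfolding valuation_class_def clopen_def by blast
qed

lemma topological_val:
  assumes "clopen w" "level s A \<le> 3" "PVar p \<notin> atoms A"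
  shows "topological s (val w A)"
proof -
  \<comment> \<open>The locale is entered at the present, clopen value of p. As p does not occur in
    A, the function to be approximated is constant with value \<open>val w A\<close>.\<close>
  interpret ackermann e w p s "w (PVar p)"
  proof
    have "w (PVar p) \<in> range e"
      using assms(1) unfolding clopen_def by blast
    then show "topological s (w (PVar p))"
      by auto
  qed (use assms(1) in \<open>simp_all add: clopen_def\<close>)
  show ?thesis
    using approximable_topological[OF approximable_val[OF assms(2) signed_fresh[OF assms(3)]]]
    by simp
qed

lemma qsat_ackermann:
  assumes w: "clopen w" and A: "level \<sigma> A \<le> 3" "PVar p \<notin> atoms A"
    and q: "admissible_quasi (\<Gamma> \<tturnstile> c)" "ineq_signed \<sigma> p c" "\<forall>i\<in>fset \<Gamma>. ineq_signed (\<not> \<sigma>) p i"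
    and near: "\<And>x. x \<in> range e \<Longrightarrow> signed_le \<sigma> (val w A) x \<Longrightarrow> qsat (w(PVar p := x)) (\<Gamma> \<tturnstile> c)"
  shows "qsat w (quasi_subst p A (\<Gamma> \<tturnstile> c))"
proof -
  interpret ackermann e w p \<sigma> "val w A"
  proof
    show "topological \<sigma> (val w A)"
      using topological_val w A by blast
  qed (use w in \<open>simp_all add: clopen_def\<close>)
  show ?thesis
    unfolding qsat_subst by (rule qsat_limit[OF q]) (simp add: near nbhd_def del: qsat.simps)
qed

lemma pearl_rule_preserves_validity:
  assumes rule: "pearl_rule q qs" and admissible: "admissible_quasi q" and valid: "qvalid clopen q"
  shows "\<forall>q'\<in>set qs. qvalid clopen q'"
  using rule
proof cases
  case (mono_bot p c \<Gamma>)
  have "clopen (w(PVar p := bot))" if "clopen w" for w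
    using that by (intro clopen_upd range_eqI[of _ e bot]) simp_all
  then show ?thesis
    using valid mono_bot by (simp add: qvalid_def qsat_subst del: quasi_subst.simps qsat.simps)
next
  case (mono_top p c \<Gamma>)
  have "clopen (w(PVar p := top))" if "clopen w" for w
    using that by (intro clopen_upd range_eqI[of _ e top]) simp_all
  then show ?thesis
    using valid mono_top by (simp add: qvalid_def qsat_subst del: quasi_subst.simps qsat.simps)
next
  case (ackermann_right p A c \<Delta>)
  have "qsat w (quasi_subst p A (\<Delta> \<tturnstile> c))" if w: "clopen w" for w
  proof (rule qsat_ackermann[where \<sigma> = True])
    fix x assume x: "x \<in> range e" "signed_le True (val w A) x"
    \<comment> \<open>The changed valuation is again admissible because x is clopen, and it
      satisfies \<open>A \<preceq> Var p\<close> because x lies above \<open>val w A\<close> and p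
      is absent from A.\<close>
    have "qsat (w(PVar p := x)) (finsert (A \<preceq> Var p) \<Delta> \<tturnstile> c)"
      using valid clopen_upd[OF w x(1)] ackermann_right(1) unfolding qvalid_def by blast
    then show "qsat (w(PVar p := x)) (\<Delta> \<tturnstile> c)"
      using x(2) ackermann_right(3) by simp
  qed (use w admissible ackermann_right in auto)
  then show ?thesis
    using ackermann_right(2) by (simp add: qvalid_def del: quasi_subst.simps qsat.simps)
next
  case (ackermann_left p A c \<Gamma>)
  have "qsat w (quasi_subst p A (\<Gamma> \<tturnstile> c))" if w: "clopen w" for w
  proof (rule qsat_ackermann[where \<sigma> = False])
    fix x assume x: "x \<in> range e" "signed_le False (val w A) x"
    have "qsat (w(PVar p := x)) (finsert (Var p \<preceq> A) \<Gamma> \<tturnstile> c)"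
      using valid clopen_upd[OF w x(1)] ackermann_left(1) unfolding qvalid_def by blast
    then show "qsat (w(PVar p := x)) (\<Gamma> \<tturnstile> c)"
      using x(2) ackermann_left(3) by simp
  qed (use w admissible ackermann_left in auto)
  then show ?thesis
    using ackermann_left(2) by (simp add: qvalid_def del: quasi_subst.simps qsat.simps)
next
  case (first_approximation j \<Gamma> A B m)
  then show ?thesis
    using valid by (simp add: qvalid_first_approximation[OF valuation_class_clopen] del: quasi_atoms.simps)
next
  case (approximation x i k l \<Gamma> c)
  then show ?thesis
    using valid by (simp add: qvalid_approximation[OF valuation_class_clopen] del: quasi_atoms.simps)
next
  case (simplify_nominal i \<Gamma> A B)
  then show ?thesis
    using valid by (simp add: qvalid_simplify_nominal[OF valuation_class_clopen] del: quasi_atoms.simps)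
next
  case (simplify_conominal m \<Gamma> A B)
  then show ?thesis
    using valid by (simp add: qvalid_simplify_conominal[OF valuation_class_clopen] del: quasi_atoms.simps)
qed (use valid in \<open>auto simp: qvalid_def sat_residual sat_adjunction sat_split\<close>)

lemma pearl_steps_preserve_validity:
  assumes "pearl_step\<^sup>*\<^sup>* us vs" "\<forall>q\<in>set us. admissible_quasi q \<and> qvalid clopen q"
  shows "\<forall>q\<in>set vs. admissible_quasi q \<and> qvalid clopen q"
  using assms
proof induction
  case (step us' vs)
  obtain q qs xs ys where *: "us' = xs @ q # ys" "vs = xs @ qs @ ys" "pearl_rule q qs"
    using step.hyps(2) by cases
  with step.IH[OF step.prems] show ?case
    using pearl_rule_admissible[OF *(3)] pearl_rule_preserves_validity[OF *(3)] by auto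
qed

lemma pure_quasi_valid:
  assumes "pure_quasi q" "qvalid clopen q"
  shows "qvalid (proper :: (atom \<Rightarrow> 'b) \<Rightarrow> bool) q"
  unfolding qvalid_def
proof (intro allI impI)
  fix w :: "atom \<Rightarrow> 'b" assume "proper w"
  \<comment> \<open>\<open>e bot\<close> is an arbitrary element of the image, invisible to a pure
    quasi-inequality.\<close>
  let ?w = "\<lambda>x. case x of PVar p \<Rightarrow> e bot | _ \<Rightarrow> w x"
  have "clopen ?w"
    using \<open>proper w\<close> by (simp add: clopen_def proper_def del: e_hom)
  with assms(2) have "qsat ?w q"
    by (simp add: qvalid_def)
  moreover have "\<forall>x\<in>quasi_atoms q. ?w x = w x"
    using assms(1) by (auto simp: pure_quasi_def split: atom.split)
  ultimately show "qsat w q"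
    using qsat_cong[of q ?w w] by blast
qed

lemma eval_hom: "eval (\<lambda>p. e (v p)) A = e (eval v A)"
  by (induction A) simp_all

end

lemma pearl_steps_reflect_validity:
  assumes "pearl_step\<^sup>*\<^sup>* us vs"
    and "\<forall>q\<in>set vs. qvalid (proper :: (atom \<Rightarrow> 'b::perfect_relevant_algebra) \<Rightarrow> bool) q"
  shows "\<forall>q\<in>set us. qvalid (proper :: (atom \<Rightarrow> 'b) \<Rightarrow> bool) q"
  using assms
proof (induction rule: converse_rtranclp_induct)
  case (step us us')
  obtain q qs xs ys where *: "us = xs @ q # ys" "us' = xs @ qs @ ys" "pearl_rule q qs"
    using step.hyps(1) by cases
  with step.IH[OF step.prems] show ?case
    using pearl_rule_reflects_validity[OF *(3)] by auto
qed

lemma val_embed: "val w (embed A) = eval (\<lambda>p. w (PVar p)) A"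
  by (induction A) simp_all

lemma runit_le_rimp:
  fixes a b :: "'b::relevant_algebra"
  shows "runit \<le> rimp a b \<longleftrightarrow> a \<le> b"
  using fusion_residual[of runit a b] by (simp add: fusion_runit)

lemma qsat_pearl_start: "qsat w (pearl_start \<phi>) \<longleftrightarrow> runit \<le> eval (\<lambda>p. w (PVar p)) \<phi>"
  by (cases \<phi>) (simp_all add: val_embed runit_le_rimp)

lemma admissible_pearl_start: "admissible_quasi (pearl_start \<phi>)"
  by (cases \<phi>) (simp_all add: level_embed cap_defs)

text \<open>If \<open>top\<close> is not below \<open>bot\<close>, generation provides a completely
  join-irreducible and a completely meet-irreducible element, which interpret all nominals and
  co-nominals.\<close>

lemma ex_proper:
  fixes v :: "nat \<Rightarrow> 'b::perfect_relevant_algebra"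
  assumes "(bot::'b) \<noteq> top"
  shows "\<exists>w. proper w \<and> (\<forall>p. w (PVar p) = v p)"
proof -
  have "\<not> top \<le> (bot::'b)"
    using assms by (simp add: top_unique)
  then obtain j m :: 'b where "completely_join_irreducible j" "completely_meet_irreducible m"
    using le_via_cji[of top "bot::'b"] le_via_cmi[of "bot::'b" top] by metis
  then show ?thesis
    by (intro exI[of _ "case_atom v (\<lambda>_. j) (\<lambda>_. m)"]) (simp add: proper_def)
qed

theorem theorem1:
  fixes \<phi> :: rfm
    and e :: "'a::relevant_algebra \<Rightarrow> 'b::perfect_relevant_algebra"
  assumes "pearl_succeeds \<phi>"
    and "canonical_extension e"
    and "valid_on TYPE('a) \<phi>"
  shows "valid_on TYPE('b) \<phi>"
proof -
  interpret canonical e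
    by unfold_locales (rule assms(2))
  obtain qs where qs: "pearl_step\<^sup>*\<^sup>* [pearl_start \<phi>] qs" "\<forall>q\<in>set qs. pure_quasi q"
    using assms(1) unfolding pearl_succeeds_def by blast
  have "qsat w (pearl_start \<phi>)" if w: "clopen w" for w
  proof -
    obtain v where "\<And>p. w (PVar p) = e (v p)"
      using w unfolding clopen_def image_iff by metis
    then have "eval (\<lambda>p. w (PVar p)) \<phi> = e (eval v \<phi>)"
      by (simp add: eval_hom)
    moreover have "runit \<le> e (eval v \<phi>)"
      using e_mono[of runit "eval v \<phi>"] assms(3) by (simp add: valid_on_def)
    ultimately show ?thesis
      by (simp add: qsat_pearl_start)
  qed
  then have "\<forall>q\<in>set qs. admissible_quasi q \<and> qvalid clopen q"
    using pearl_steps_preserve_validity[OF qs(1)] admissible_pearl_start by (simp add: qvalid_def)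
  then have "\<forall>q\<in>set qs. qvalid (proper :: (atom \<Rightarrow> 'b) \<Rightarrow> bool) q"
    using qs(2) pure_quasi_valid by blast
  then have start: "qvalid (proper :: (atom \<Rightarrow> 'b) \<Rightarrow> bool) (pearl_start \<phi>)"
    using pearl_steps_reflect_validity[OF qs(1)] by simp
  have "runit \<le> eval v \<phi>" for v :: "nat \<Rightarrow> 'b"
  proof (cases "(bot::'b) = top")
    \<comment> \<open>There are no proper valuations here, so \<open>start\<close> holds vacuously;
      but all elements coincide.\<close>
    case True
    then show ?thesis
      by (metis bot_least top_greatest order_trans)
  next
    case False
    then obtain w where "proper w" "\<And>p. w (PVar p) = v p"
      using ex_proper by metis
    then show ?thesis
      using start qsat_pearl_start[of w \<phi>] by (simp add: qvalid_def)
  qed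
  then show ?thesis
    by (simp add: valid_on_def)
qed

end
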